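(* The word metric in $\mathrm{DA}(\mathbb{T})$ with respect to the generating set $S_1=\delta_o^{\mathfrak{S}_q}\{\alpha^{\pm1}\}\delta_o^{\mathfrak{S}_q}$ is given by $$|g|_{S_1}=\mathrm{TSP}_{\mathbb{T}}(\mathrm{supp}(g);o,o.g^{-1})=2\ell(g)-d_{\mathbb{T}}(o,o.g^{-1})$$ for all $g\in\mathrm{DA}(\mathbb{T})\setminus\delta_o^{\mathfrak{S}_q}$. Moreover $|\delta_o^\sigma|_{S_1}=2$ for every non-trivial $\sigma\in\mathfrak{S}_q$.
   Context: Tree and groups. Fix an integer $q\ge 2$, let $\mathcal{A}_q=\{0,\dots,q-1\}$, and let the symmetric group $\mathfrak{S}_q$ act on $\mathcal{A}_q$ on the right, $t\mapsto t.\sigma$. For $m\in\mathbb{Z}$ let $H_m$ be the set of sequences $(u_k)_{k\le m}$ indexed by integers $k\le m$, with values in $\mathcal{A}_q$, and equal to $0$ for all sufficiently negative $k$. The $(q+1)$-regular tree $\mathbb{T}$ has vertex set $\bigsqcup_{m\in\mathbb{Z}}H_m$, each vertex of $H_m$ being joined by an edge to its ancestor in $H_{m-1}$ obtained by deleting the last entry; for a vertex $v$ and $t\in\mathcal{A}_q$, $vt$ is the child of $v$ obtained by appending $t$. $d_{\mathbb{T}}$ is the graph distance. Let $\omega(n)\in H_{-n}$ be the zero sequence, $o=\omega(0)$, and $\omega$ the end of $\mathbb{T}$ represented by the ray $(\omega(n))_{n\ge0}$. $\mathrm{Aff}(\mathbb{T})$ is the group of graph automorphisms of $\mathbb{T}$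 fixing $\omega$; it acts on the right ($v\mapsto v.g$; in $gh$, $g$ is applied first). Put $\beta(v)=m$ for $v\in H_m$ and let $\Phi:\mathrm{Aff}(\mathbb{T})\to\mathbb{Z}$ be the homomorphism $\Phi(g)=\beta(v.g)-\beta(v)$ (independent of $v$), with kernel $\mathrm{Hor}(\mathbb{T})$. Let $\alpha\in\mathrm{Aff}(\mathbb{T})$ be the shift $(u_k)_{k\le m}\mapsto(u_{k-1})_{k\le m+1}$, so $\Phi(\alpha)=1$. For $\gamma\in\mathrm{Hor}(\mathbb{T})$ the portrait of $\gamma$ is the function $v\mapsto\gamma[v]\in\mathfrak{S}_q$ determined by $(vt).\gamma=(v.\gamma)(t.\gamma[v])$ for all vertices $v$ and $t\in\mathcal{A}_q$. Every $g\in\mathrm{Aff}(\mathbb{T})$ is uniquely $g=\gamma\alpha^m$ with $\gamma\in\mathrm{Hor}(\mathbb{T})$, $m\in\mathbb{Z}$, and one sets $g[v]:=\gamma[v]$. The discrete affine group is $\mathrm{DA}(\mathbb{T})=\{g\in\mathrm{Aff}(\mathbb{T}): g[v]=e \text{ for all but finitely many } v\}$. For $g\in\mathrm{DA}(\mathbb{T})$, $\mathrm{supp}(g)=\{v: g[v]\ne e\}$. For $\sigma\in\mathfrak{S}_q$, $\delta_o^\sigma\in\mathrm{Hor}(\mathbb{T})$ is the element with portrait equal to $\sigma$ at $o$ and $e$ at every other vertex; $\delta_o^{\mathfrak{S}_q}=\{\delta_o^\sigma:\sigma\in\mathfrak{S}_q\}$. $S_1=\{\delta_o^{\sigma}\alpha^{\varepsilon}\delta_o^{\sigma'}:\sigma,\sigma'\in\mathfrak{S}_q,\varepsilon=\pm1\}$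 is a symmetric generating set of $\mathrm{DA}(\mathbb{T})$ and $|g|_{S_1}$ is the word length of $g$. For a finite set $A$ of vertices and vertices $x,y$, $\mathrm{TSP}_{\mathbb{T}}(A;x,y)$ is the length of a shortest path in $\mathbb{T}$ (edges may be repeated) starting at $x$, visiting all vertices of $A$, and ending at $y$. $\ell(g)$ is the number of edges of the smallest subtree of $\mathbb{T}$ containing $\mathrm{supp}(g)\cup\{o,o.g^{-1}\}$. *)

theory Defs
  imports "HOL-Algebra.Group" "HOL-Combinatorics.Permutations" "HOL-Library.Extended_Nat"
begin

section \<open>Undirected graphs\<close>

record 'a ugraph =
  nodes :: "'a set"
  edges :: "'a set set"

definition walk :: "'a ugraph \<Rightarrow> 'a list \<Rightarrow> bool" where
  "walk G p \<longleftrightarrow>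
     p \<noteq> [] \<and> set p \<subseteq> nodes G \<and> successively (\<lambda>x y. {x, y} \<in> edges G) p"

definition walk_between :: "'a ugraph \<Rightarrow> 'a \<Rightarrow> 'a list \<Rightarrow> 'a \<Rightarrow> bool" where
  "walk_between G x p y \<longleftrightarrow> walk G p \<and> hd p = x \<and> last p = y"

text \<open>A walk is the list of its vertices, so one of length \<open>n\<close> has \<open>n + 1\<close> entries.\<close>

definition graph_dist :: "'a ugraph \<Rightarrow> 'a \<Rightarrow> 'a \<Rightarrow> nat" where
  "graph_dist G x y = (LEAST n. \<exists>p. walk_between G x p y \<and> length p = Suc n)"

definition TSP :: "'a ugraph \<Rightarrow> 'a set \<Rightarrow> 'a \<Rightarrow> 'a \<Rightarrow> nat" where
  "TSP G A x y = (LEAST n. \<exists>p. walk_between G x p y \<and> A \<subseteq> set p \<and> length p = Suc n)"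

definition is_tree :: "'a ugraph \<Rightarrow> bool" where
  "is_tree G \<longleftrightarrow>
     nodes G \<noteq> {} \<and>
     (\<forall>x\<in>nodes G. \<forall>y\<in>nodes G. \<exists>p. walk_between G x p y) \<and>
     \<not> (\<exists>p. walk G p \<and> distinct p \<and> length p \<ge> 3 \<and> {last p, hd p} \<in> edges G)"

definition subgraph :: "'a ugraph \<Rightarrow> 'a ugraph \<Rightarrow> bool" where
  "subgraph H G \<longleftrightarrow>
     nodes H \<subseteq> nodes G \<and> edges H \<subseteq> edges G \<and> \<Union> (edges H) \<subseteq> nodes H"

definition subtree :: "'a ugraph \<Rightarrow> 'a ugraph \<Rightarrow> bool" where
  "subtree H G \<longleftrightarrow> subgraph H G \<and> is_tree H"

definition smallest_subtree :: "'a ugraph \<Rightarrow> 'a set \<Rightarrow> 'a ugraph" where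
  "smallest_subtree G A =
     (THE H. subtree H G \<and> A \<subseteq> nodes H \<and>
             (\<forall>H'. subtree H' G \<and> A \<subseteq> nodes H' \<longrightarrow> subgraph H H'))"

text \<open>Automorphisms are extended by the identity outside the vertex set.\<close>

definition automorphism :: "'a ugraph \<Rightarrow> ('a \<Rightarrow> 'a) \<Rightarrow> bool" where
  "automorphism G g \<longleftrightarrow>
     g permutes nodes G \<and>
     (\<forall>x\<in>nodes G. \<forall>y\<in>nodes G. {g x, g y} \<in> edges G \<longleftrightarrow> {x, y} \<in> edges G)"

text \<open>Two rays of a tree represent the same end iff they eventually coincide, up to a shift
  of the parametrisation.\<close>

definition same_end :: "(nat \<Rightarrow> 'a) \<Rightarrow> (nat \<Rightarrow> 'a) \<Rightarrow> bool" where
  "same_end r s \<longleftrightarrow> (\<exists>i j. \<forall>n. r (i + n) = s (j + n))"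


section \<open>Word length\<close>

text \<open>The value is \<open>\<infinity>\<close> when \<open>g\<close> is not a product of elements of \<open>S\<close>.  No inverses are
  inserted, so \<open>S\<close> is meant to be symmetric.\<close>

definition word_length :: "('a, 'b) monoid_scheme \<Rightarrow> 'a set \<Rightarrow> 'a \<Rightarrow> enat" where
  "word_length G S g =
     (INF w \<in> {w. set w \<subseteq> S \<and> foldr (\<lambda>x y. x \<otimes>\<^bsub>G\<^esub> y) w \<one>\<^bsub>G\<^esub> = g}. enat (length w))"


section \<open>The regular tree with a distinguished end\<close>

text \<open>A sequence \<open>(u\<^sub>k)\<close> indexed by the integers \<open>k \<le> m\<close> is encoded as the pair \<open>(m, u)\<close> with
  \<open>u\<close> extended by \<open>0\<close> to all \<open>k > m\<close>.\<close>

type_synonym vertex = "int \<times> (int \<Rightarrow> nat)"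

definition level_set :: "nat \<Rightarrow> int \<Rightarrow> vertex set" where
  "level_set q m = {(m, u) | u. (\<forall>k\<le>m. u k < q) \<and> (\<forall>k>m. u k = 0) \<and> (\<exists>N. \<forall>k\<le>N. u k = 0)}"

abbreviation \<beta> :: "vertex \<Rightarrow> int" where
  "\<beta> \<equiv> fst"

definition ancestor :: "vertex \<Rightarrow> vertex" where
  "ancestor = (\<lambda>(m, u). (m - 1, u(m := 0)))"

definition child :: "vertex \<Rightarrow> nat \<Rightarrow> vertex" where
  "child = (\<lambda>(m, u) t. (m + 1, u(m + 1 := t)))"

definition Tr :: "nat \<Rightarrow> vertex ugraph" where
  "Tr q = \<lparr>nodes = (\<Union>m. level_set q m), edges = {{v, ancestor v} | v. v \<in> (\<Union>m. level_set q m)}\<rparr>"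

definition \<omega> :: "nat \<Rightarrow> vertex" where
  "\<omega> n = (- int n, \<lambda>_. 0)"

abbreviation origin :: vertex where
  "origin \<equiv> \<omega> 0"


section \<open>The affine group of the tree and its discrete subgroup\<close>

text \<open>The groups act on the right: \<open>v.g\<close> is written \<open>g v\<close>, and the product of \<open>g\<close> and \<open>h\<close>
  applies \<open>g\<close> first.\<close>

definition Aff :: "nat \<Rightarrow> (vertex \<Rightarrow> vertex) monoid" where
  "Aff q = \<lparr>carrier = {g. automorphism (Tr q) g \<and> same_end (g \<circ> \<omega>) \<omega>},
            monoid.mult = (\<lambda>g h. h \<circ> g),
            one = id\<rparr>"

definition \<Phi> :: "nat \<Rightarrow> (vertex \<Rightarrow> vertex) \<Rightarrow> int" where
  "\<Phi> q g = (THE m. \<forall>v\<in>nodes (Tr q). \<beta> (g v) - \<beta> v = m)"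

definition Hor :: "nat \<Rightarrow> (vertex \<Rightarrow> vertex) set" where
  "Hor q = {g \<in> carrier (Aff q). \<Phi> q g = 0}"

definition \<alpha> :: "nat \<Rightarrow> vertex \<Rightarrow> vertex" where
  "\<alpha> q v = (if v \<in> nodes (Tr q) then (fst v + 1, \<lambda>k. snd v (k - 1)) else v)"

abbreviation Sym :: "nat \<Rightarrow> (nat \<Rightarrow> nat) set" where
  "Sym q \<equiv> {\<sigma>. \<sigma> permutes {..<q}}"

definition hor_portrait :: "nat \<Rightarrow> (vertex \<Rightarrow> vertex) \<Rightarrow> vertex \<Rightarrow> nat \<Rightarrow> nat" where
  "hor_portrait q \<gamma> v = (THE \<sigma>. \<sigma> \<in> Sym q \<and> (\<forall>t<q. \<gamma> (child v t) = child (\<gamma> v) (\<sigma> t)))"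

definition hor_part :: "nat \<Rightarrow> (vertex \<Rightarrow> vertex) \<Rightarrow> vertex \<Rightarrow> vertex" where
  "hor_part q g =
     (THE \<gamma>. \<gamma> \<in> Hor q \<and> (\<exists>m::int. g = \<gamma> \<otimes>\<^bsub>Aff q\<^esub> (\<alpha> q [^]\<^bsub>Aff q\<^esub> m)))"

definition portrait :: "nat \<Rightarrow> (vertex \<Rightarrow> vertex) \<Rightarrow> vertex \<Rightarrow> nat \<Rightarrow> nat" where
  "portrait q g = hor_portrait q (hor_part q g)"

definition supp :: "nat \<Rightarrow> (vertex \<Rightarrow> vertex) \<Rightarrow> vertex set" where
  "supp q g = {v \<in> nodes (Tr q). portrait q g v \<noteq> id}"

definition DA :: "nat \<Rightarrow> (vertex \<Rightarrow> vertex) monoid" where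
  "DA q = (Aff q)\<lparr>carrier := {g \<in> carrier (Aff q). finite (supp q g)}\<rparr>"

definition \<delta> :: "nat \<Rightarrow> (nat \<Rightarrow> nat) \<Rightarrow> vertex \<Rightarrow> vertex" where
  "\<delta> q \<sigma> = (THE \<gamma>. \<gamma> \<in> Hor q \<and>
     (\<forall>v\<in>nodes (Tr q). portrait q \<gamma> v = (if v = origin then \<sigma> else id)))"

definition S\<^sub>1 :: "nat \<Rightarrow> (vertex \<Rightarrow> vertex) set" where
  "S\<^sub>1 q = {\<delta> q \<sigma> \<otimes>\<^bsub>Aff q\<^esub> (\<alpha> q [^]\<^bsub>Aff q\<^esub> \<epsilon>) \<otimes>\<^bsub>Aff q\<^esub> \<delta> q \<sigma>' | \<sigma> \<sigma>' \<epsilon>.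
             \<sigma> \<in> Sym q \<and> \<sigma>' \<in> Sym q \<and> \<epsilon> \<in> {1, - 1 :: int}}"

definition ell :: "nat \<Rightarrow> (vertex \<Rightarrow> vertex) \<Rightarrow> nat" where
  "ell q g = card (edges (smallest_subtree (Tr q)
                            (supp q g \<union> {origin, (inv\<^bsub>Aff q\<^esub> g) origin})))"

end

theory Submission imports Defs begin

text \<open>In a tree, every edge separating two of the points to be visited must be crossed, and it must
  be crossed twice if it does not separate the two endpoints \<open>x\<close> and \<open>y\<close>; this bound is attained, so
  a shortest walk has length \<open>2 \<ell> - d(x, y)\<close>.

  An element \<open>g\<close> is determined by its portrait and its height shift, and may be pictured as a
  lamp configuration (the portrait) with a cursor at \<open>o.g\<^sup>-\<^sup>1\<close>.  Multiplying \<open>g\<close> on the right by an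
  element of \<open>S\<^sub>1\<close> changes the portrait at the cursor, moves the cursor to a neighbour, and changes
  the portrait there.  So a word of length \<open>n\<close> traces a walk of length \<open>n\<close> that starts at \<open>o\<close> and
  visits the support.  Conversely each nonempty walk of this kind is traced by a word, which is
  found by undoing the walk from its end.\<close>

section \<open>Walks in undirected graphs\<close>

text \<open>Each vertex has one parent towards the end, so an edge can be named by its lower
  endpoint and lying on one side of it becomes the relation \<open>below\<close>. Distances, subtree
  sizes and walk lengths then all reduce to cardinalities of \<open>cut\<close>, and a step of a
  walk changes the side of one edge only. The obstacle in building words is that undoing a step
  leaves one permutation at the cursor with two tasks: it must erase the label there if the
  remaining walk does not return, and it must steer the cursor back to the preceding vertex.
  Stepping back to the ancestor puts no condition on the permutation, stepping back to a child
  prescribes one value. The undoing stops at the one-vertex walk, where a label at the origin may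
  survive as a factor \<open>\<delta> q \<tau>\<close>. The first letter of a nonempty word absorbs
  this factor, the empty word cannot; this is why the elements \<open>\<delta> q \<sigma>\<close>
  are exceptional.\<close>

lemma successively_set:
  assumes "successively P p"
  shows "successively (\<lambda>a b. P a b \<and> a \<in> set p \<and> b \<in> set p) p"
  using assms by (auto simp: successively_conv_nth)

lemma successively_subset:
  assumes "successively (\<lambda>a b. {a, b} \<in> F) p" "p \<noteq> []" "hd p \<in> N" "\<Union> F \<subseteq> N"
  shows "set p \<subseteq> N"
  using assms
proof (induction p rule: induct_list012)
  case (3 x y zs)
  then have "y \<in> N" by auto
  with 3 show ?case by auto
qed auto

lemma walk_between_Cons:
  assumes "walk_between G x' p y" "x \<in> nodes G" "{x, x'} \<in> edges G"
  shows "walk_between G x (x # p) y"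
  using assms by (cases p) (auto simp: walk_between_def walk_def)

lemma walk_between_snoc:
  assumes "walk_between G x p y" "y' \<in> nodes G" "{y, y'} \<in> edges G"
  shows "walk_between G x (p @ [y']) y'"
  using assms by (auto simp: walk_between_def walk_def successively_append_iff)

lemma walk_between_rev:
  assumes "walk_between G x p y"
  shows "walk_between G y (rev p) x"
proof -
  have "successively (\<lambda>a b. {a, b} \<in> edges G) (rev p)"
    using assms by (simp add: walk_between_def walk_def insert_commute)
  then show ?thesis
    using assms by (auto simp: walk_between_def walk_def hd_rev last_rev)
qed

lemma walk_between_trans:
  assumes "walk_between G x p y" "walk_between G y r z"
  shows "\<exists>s. walk_between G x s z"
proof -
  have "walk_between G x (p @ tl r) z"
    using assms by (cases r) (auto simp: walk_between_def walk_def successively_append_iff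
        successively_Cons)
  then show ?thesis ..
qed

lemma walk_prefix:
  assumes "walk G p" "x \<in> set p"
  shows "\<exists>r. walk_between G (hd p) r x"
proof -
  obtain ys zs where p: "p = ys @ x # zs"
    using assms(2) by (meson split_list)
  have "walk_between G (hd p) (ys @ [x]) x"
    using assms(1) successively_append_iff[of _ "ys @ [x]" zs] unfolding p
    by (cases ys) (auto simp: walk_between_def walk_def)
  then show ?thesis ..
qed

lemma walk_connects:
  assumes "walk G p" "x \<in> set p" "y \<in> set p"
  shows "\<exists>r. walk_between G x r y"
  using walk_prefix[OF assms(1,2)] walk_prefix[OF assms(1,3)]
    walk_between_rev walk_between_trans by metis

lemma smallest_subtree_eq:
  assumes "subtree H G" "A \<subseteq> nodes H"
    and "\<And>H'. subtree H' G \<Longrightarrow> A \<subseteq> nodes H' \<Longrightarrow> subgraph H H'"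
  shows "smallest_subtree G A = H"
  unfolding smallest_subtree_def
proof (rule the_equality)
  fix K assume "subtree K G \<and> A \<subseteq> nodes K \<and>
    (\<forall>H'. subtree H' G \<and> A \<subseteq> nodes H' \<longrightarrow> subgraph K H')"
  then have "subgraph K H" "subgraph H K" using assms by auto
  then show "K = H" by (auto simp: subgraph_def)
qed (use assms in auto)

section \<open>Trees directed towards an end\<close>

text \<open>There is no root: \<open>par\<close> never stops. The strictly falling height excludes
  cycles of \<open>par\<close>, and common ancestors take the place of connectedness.\<close>

locale tree_with_end =
  fixes G :: "'a ugraph" and par :: "'a \<Rightarrow> 'a" and h :: "'a \<Rightarrow> int"
  assumes edges_eq: "edges G = (\<lambda>v. {v, par v}) ` nodes G"
    and par_nodes: "v \<in> nodes G \<Longrightarrow> par v \<in> nodes G"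
    and h_par: "v \<in> nodes G \<Longrightarrow> h (par v) = h v - 1"
    and common_ancestor:
      "x \<in> nodes G \<Longrightarrow> y \<in> nodes G \<Longrightarrow> \<exists>m n. (par ^^ m) x = (par ^^ n) y"
begin

section \<open>Branches and separating edges\<close>

text \<open>For fixed \<open>v\<close>, the vertices \<open>x\<close> form the component that
  contains \<open>v\<close> once the edge \<open>{v, par v}\<close> is deleted.\<close>

definition below :: "'a \<Rightarrow> 'a \<Rightarrow> bool" where
  "below v x \<longleftrightarrow> (\<exists>n. (par ^^ n) x = v)"

text \<open>Edges are represented by their lower endpoint; \<open>cut B\<close> are the edges whose removal
  separates two points of \<open>B\<close>.\<close>

definition cut :: "'a set \<Rightarrow> 'a set" where
  "cut B = {v \<in> nodes G. (\<exists>b\<in>B. below v b) \<and> (\<exists>b\<in>B. \<not> below v b)}"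

lemma funpow_nodes: "x \<in> nodes G \<Longrightarrow> (par ^^ n) x \<in> nodes G"
  by (induction n) (auto simp: par_nodes)

lemma h_funpow: "x \<in> nodes G \<Longrightarrow> h ((par ^^ n) x) = h x - int n"
  by (induction n) (auto simp: h_par funpow_nodes)

lemma below_refl: "below v v"
  unfolding below_def by (rule exI[of _ 0]) simp

lemma below_par_iff: "below v x \<longleftrightarrow> x = v \<or> below v (par x)"
proof
  assume "below v x"
  then obtain n where "(par ^^ n) x = v" by (auto simp: below_def)
  then show "x = v \<or> below v (par x)"
    by (cases n) (auto simp: below_def funpow_swap1)
next
  assume "x = v \<or> below v (par x)"
  then show "below v x"
  proof
    assume "below v (par x)"
    then obtain n where "(par ^^ n) (par x) = v" by (auto simp: below_def)
    then have "(par ^^ Suc n) x = v" by (simp add: funpow_swap1)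
    then show ?thesis unfolding below_def by blast
  qed (simp add: below_refl)
qed

lemma below_h: "below v x \<Longrightarrow> x \<in> nodes G \<Longrightarrow> h v \<le> h x"
  by (auto simp: below_def h_funpow)

lemma not_below_par: "v \<in> nodes G \<Longrightarrow> \<not> below v (par v)"
  using below_h[of v "par v"] h_par[of v] par_nodes[of v] by force

lemma below_unique:
  assumes "below v x" "below w x" "h v = h w" "x \<in> nodes G"
  shows "v = w"
  using assms by (auto simp: below_def h_funpow)

lemma below_par: "below v x \<Longrightarrow> below (par v) x"
  unfolding below_def using funpow.simps(2) comp_apply by metis

lemma edge_inj:
  assumes "v \<in> nodes G" "w \<in> nodes G" "{v, par v} = {w, par w}"
  shows "v = w"
proof (rule ccontr)
  assume "v \<noteq> w"
  then have "v = par w" "w = par v" using assms(3) by (auto simp: doubleton_eq_iff)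
  then show False using h_par[of v] h_par[of w] assms by auto
qed

text \<open>The engine of all counting: a step of a walk toggles the side with respect to the edge
  it crosses and to no other.\<close>

lemma edge_below:
  assumes "{x, x'} = {v, par v}" "v \<in> nodes G"
  shows "below v x \<noteq> below v x'" "w \<noteq> v \<Longrightarrow> below w x = below w x'"
  using assms below_refl[of v] not_below_par[of v] below_par_iff[of w v]
  by (auto simp: doubleton_eq_iff)

lemma edge_towards:
  assumes "x \<in> nodes G" "z \<in> nodes G" "x \<noteq> z"
  obtains x' v where "x' \<in> nodes G" "v \<in> nodes G" "{x, x'} = {v, par v}"
    "below v x \<noteq> below v z"
proof (cases "below x z")
  case True
  then obtain n where n: "(par ^^ n) z = x" by (auto simp: below_def)
  with assms obtain k where k: "n = Suc k" by (cases n) auto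
  \<comment> \<open>The last ancestor of \<open>z\<close> before \<open>x\<close>, that is, the
    child of \<open>x\<close> on the side of \<open>z\<close>.\<close>
  define v where "v = (par ^^ k) z"
  have v: "v \<in> nodes G" "par v = x" "below v z"
    using n k assms funpow_nodes by (auto simp: v_def below_def)
  moreover have "\<not> below v x" using not_below_par v by blast
  ultimately show ?thesis using that[of v v] by auto
next
  case False
  then show ?thesis using that[of "par x" x] assms below_refl par_nodes by auto
qed

text \<open>If such an edge leads up from \<open>x\<close>, then \<open>z\<close> is not below
  \<open>x\<close>; if it leads down, then \<open>z\<close> is below a child of \<open>x\<close>,
  and \<open>z\<close> has only one ancestor of each height.\<close>

lemma edge_towards_unique:
  assumes "{x, x'} = {v, par v}" "{x, x''} = {w, par w}" "v \<in> nodes G" "w \<in> nodes G"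
    "z \<in> nodes G" "below v x \<noteq> below v z" "below w x \<noteq> below w z"
  shows "v = w"
proof -
  have v: "v = x \<or> par v = x" and w: "w = x \<or> par w = x"
    using assms(1,2) by (auto simp: doubleton_eq_iff)
  have *: "below u z" "below x z" if "par u = x" "below u x \<noteq> below u z" "u \<in> nodes G" for u
    using that not_below_par[of u] below_par by auto
  show ?thesis
  proof (cases "v = x \<or> w = x")
    case True
    then show ?thesis using v w * assms below_refl by metis
  next
    case False
    then have "below v z" "below w z" "h v = h w"
      using v w * assms h_par[of v] h_par[of w] by auto
    then show ?thesis using below_unique assms by blast
  qed
qed

text \<open>A vertex of the cut is an ancestor of some \<open>x\<close> in \<open>B\<close> but not
  of some \<open>y\<close> in \<open>B\<close>. On the way up from \<open>x\<close> it must
  therefore come before a common ancestor of the two.\<close>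

lemma finite_cut:
  assumes "finite B" "B \<subseteq> nodes G"
  shows "finite (cut B)"
proof -
  have "finite {v. below v x \<and> \<not> below v y}" if xy: "x \<in> nodes G" "y \<in> nodes G" for x y
  proof -
    obtain m n where mn: "(par ^^ m) x = (par ^^ n) y" using common_ancestor xy by blast
    have "v \<in> (\<lambda>k. (par ^^ k) x) ` {..<m}" if "below v x" "\<not> below v y" for v
    proof -
      obtain k where k: "(par ^^ k) x = v" using \<open>below v x\<close> by (auto simp: below_def)
      have "k < m"
      proof (rule ccontr)
        assume "\<not> k < m"
        then have "v = (par ^^ (k - m)) ((par ^^ m) x)"
          using k funpow_add[of "k - m" m par] by simp
        then have "(par ^^ (k - m + n)) y = v" by (simp add: mn funpow_add)
        then show False using that(2) by (auto simp: below_def)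
      qed
      then show ?thesis using k by auto
    qed
    then have "{v. below v x \<and> \<not> below v y} \<subseteq> (\<lambda>k. (par ^^ k) x) ` {..<m}" by blast
    then show ?thesis by (rule finite_subset) simp
  qed
  moreover have "cut B \<subseteq> (\<Union>x\<in>B. \<Union>y\<in>B. {v. below v x \<and> \<not> below v y})"
    by (auto simp: cut_def)
  ultimately show ?thesis
    using assms by (meson finite_UN_I finite_subset subsetD)
qed

text \<open>The edge set \<open>F\<close> is left free so that the lemma serves both for walks in a
  subgraph and for walks in the tree with one edge removed.\<close>

lemma successively_below:
  assumes "successively (\<lambda>a b. {a, b} \<in> F) p" "F \<subseteq> edges G" "v \<in> nodes G"
    "{v, par v} \<notin> F" "x \<in> set p"
  shows "below v x = below v (hd p)"
  using assms(1,5)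
proof (induction p rule: induct_list012)
  case (3 a b zs)
  then obtain w where w: "w \<in> nodes G" "{a, b} = {w, par w}" "{a, b} \<in> F"
    using assms(2) by (auto simp: edges_eq)
  then have "w \<noteq> v" using assms(4) by auto
  then have "below v a = below v b" using edge_below(2)[of a b w v] w by auto
  then show ?case using 3 by auto
qed auto

lemma cut_crossed:
  assumes "successively (\<lambda>a b. {a, b} \<in> F) p" "F \<subseteq> edges G" "v \<in> cut B" "B \<subseteq> set p"
  shows "{v, par v} \<in> F"
proof (rule ccontr)
  assume "{v, par v} \<notin> F"
  then have "\<forall>x\<in>B. below v x = below v (hd p)"
    using successively_below[OF assms(1,2)] assms(3,4) by (auto simp: cut_def)
  then show False using assms(3) by (auto simp: cut_def)
qed

text \<open>All edges other than the one between \<open>x\<close> and \<open>x'\<close> see these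
  two vertices on the same side, so \<open>x'\<close> can stand in for \<open>x\<close> even after
  \<open>x\<close> is struck off \<open>A\<close>.\<close>

lemma cut_move:
  assumes "{x, x'} = {v, par v}" "v \<in> nodes G"
  shows "cut (insert x (insert y A)) - {v} = cut (insert x' (insert y (A - {x}))) - {v}"
proof -
  have "below w x = below w x'" if "w \<noteq> v" for w
    using edge_below(2) assms that by blast
  then show ?thesis by (fastforce simp: cut_def)
qed

lemma cut_pair_move:
  assumes "{x, x'} = {v, par v}" "v \<in> nodes G"
  shows "cut {x, y} - {v} = cut {x', y} - {v}"
proof -
  have "below w x = below w x'" if "w \<noteq> v" for w
    using edge_below(2) assms that by blast
  then show ?thesis by (auto simp: cut_def)
qed

section \<open>Lengths of shortest visiting walks\<close>

text \<open>Twice the whole cut minus the cut of the endpoints drops by at most one per step. A step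
  towards \<open>y\<close> removes its edge from the cut of the endpoints and at most that edge from
  the whole cut. A step away from \<open>y\<close> adds its edge to the cut of the endpoints and
  removes nothing from the whole cut.\<close>

lemma walk_length_ge:
  assumes "walk_between G x p y" "A \<subseteq> set p" "finite A"
  shows "Suc (2 * card (cut (insert x (insert y A)))) \<le> length p + card (cut {x, y})"
  using assms
proof (induction p arbitrary: x A rule: induct_list012)
  case 1
  then show ?case by (simp add: walk_between_def walk_def)
next
  case (2 a)
  then have eqs: "insert x (insert y A) = {x}" "{x, y} = {x}" "cut {x} = {}"
    by (auto simp: walk_between_def cut_def)
  show ?case unfolding eqs by simp
next
  case (3 a x' zs)
  have [simp]: "a = x" using 3 by (auto simp: walk_between_def)
  have x': "walk_between G x' (x' # zs) y"
    using 3 by (auto simp: walk_between_def walk_def)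
  have nodes: "set (x # x' # zs) \<subseteq> nodes G" "y \<in> nodes G"
    using 3 last_in_set[of "a # x' # zs"] by (auto simp: walk_between_def walk_def simp del: last.simps)
  obtain v where v: "{x, x'} = {v, par v}" "v \<in> nodes G"
    using 3 by (auto simp: walk_between_def walk_def edges_eq)
  let ?B = "cut (insert x (insert y A))" and ?B' = "cut (insert x' (insert y (A - {x})))"
  let ?C = "cut {x, y}" and ?C' = "cut {x', y}"
  have "A - {x} \<subseteq> set (x' # zs)" using 3(4) by auto
  then have IH: "Suc (2 * card ?B') \<le> length (x' # zs) + card ?C'"
    using 3(2)[OF x', of "A - {x}"] 3(5) by blast
  have fin: "finite ?B" "finite ?B'" "finite ?C" "finite ?C'"
    using nodes 3 by (auto intro!: finite_cut)
  have eqs: "?B - {v} = ?B' - {v}" "?C - {v} = ?C' - {v}"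
    using cut_move[OF v] cut_pair_move[OF v] by auto
  have opp: "below v x \<noteq> below v x'" using edge_below v by blast
  show ?case
  proof (cases "v \<in> ?C")
    case True
    then have "v \<notin> ?C'" using opp by (auto simp: cut_def)
    then have "?C = insert v ?C'" using eqs True by auto
    then have "card ?C = Suc (card ?C')" using \<open>v \<notin> ?C'\<close> fin by simp
    moreover have "?B \<subseteq> insert v ?B'" using eqs by auto
    then have "card ?B \<le> card (insert v ?B')" using fin by (simp add: card_mono)
    then have "card ?B \<le> Suc (card ?B')" using fin by (simp add: card_insert_if split: if_splits)
    ultimately show ?thesis using IH by simp
  next
    case False
    then have "v \<in> ?C'" using opp v(2) by (auto simp: cut_def)
    then have "?C' = insert v ?C" using eqs by auto
    then have "card ?C' = Suc (card ?C)" using False fin by simp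
    moreover have "v \<in> ?B'" using \<open>v \<in> ?C'\<close> by (auto simp: cut_def)
    then have "?B \<subseteq> ?B'" using eqs by auto
    then have "card ?B \<le> card ?B'" using fin by (simp add: card_mono)
    ultimately show ?thesis using IH by simp
  qed
qed

text \<open>Whenever possible, the optimal walk first enters a branch at \<open>x\<close> that meets \<open>A\<close> but does
  not contain \<open>y\<close>; otherwise all that remains to be visited lies on the side of \<open>y\<close>.\<close>

lemma optimal_walk_exists:
  assumes "x \<in> nodes G" "y \<in> nodes G" "finite A" "A \<subseteq> nodes G"
  shows "\<exists>p. walk_between G x p y \<and> A \<subseteq> set p \<and>
    successively (\<lambda>a b. {a, b} \<in> (\<lambda>v. {v, par v}) ` cut (insert x (insert y A))) p \<and>
    length p + card (cut {x, y}) = Suc (2 * card (cut (insert x (insert y A))))"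
  using assms
proof (induction "2 * card (cut (insert x (insert y A))) - card (cut {x, y})"
    arbitrary: x A rule: less_induct)
  case less
  let ?B = "cut (insert x (insert y A))" and ?C = "cut {x, y}"
  have finB: "finite ?B" and finC: "finite ?C" using less.prems by (auto intro!: finite_cut)
  \<comment> \<open>Keeps the natural subtraction in the induction measure, the length of the walk
    to be found, from truncating.\<close>
  have "?C \<subseteq> ?B" by (auto simp: cut_def)
  then have CB: "card ?C \<le> card ?B" using finB by (simp add: card_mono)
  show ?case
  proof (cases "insert y A \<subseteq> {x}")
    case True
    then have eq: "insert x (insert y A) = {x}" "{x, y} = {x}" "x = y" by auto
    have "cut {x} = {}" by (auto simp: cut_def)
    then show ?thesis unfolding eq(1,2) using eq(3) less.prems True
      by (intro exI[of _ "[x]"]) (auto simp: walk_between_def walk_def)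
  next
    case False
    obtain x' v where v: "x' \<in> nodes G" "v \<in> nodes G" "{x, x'} = {v, par v}"
      and choice: "(v \<in> ?B \<and> v \<notin> ?C) \<or> (v \<in> ?C \<and> (\<forall>z\<in>A - {x}. below v z \<noteq> below v x))"
    proof (cases "\<exists>x'\<in>nodes G. \<exists>v\<in>nodes G. {x, x'} = {v, par v} \<and> v \<in> ?B \<and> v \<notin> ?C")
      case True
      then show ?thesis using that by blast
    next
      case nobranch: False
      \<comment> \<open>With no side branch left, the first edge from \<open>x\<close> towards any
        remaining point also separates \<open>x\<close> from \<open>y\<close>. By uniqueness of the
        first edge towards \<open>y\<close>, it is the same edge for all of them.\<close>
      have same: "\<exists>x'\<in>nodes G. \<exists>v\<in>nodes G. {x, x'} = {v, par v} \<and> below v x \<noteq> below v z \<and> v \<in> ?C"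
        if z: "z \<in> insert y A" "z \<noteq> x" for z
      proof -
        obtain x' v where "x' \<in> nodes G" "v \<in> nodes G" "{x, x'} = {v, par v}"
          "below v x \<noteq> below v z"
          using edge_towards[of x z] less.prems z by (metis insertE subsetD)
        moreover from this have "v \<in> ?B" using z by (auto simp: cut_def)
        ultimately show ?thesis using nobranch by blast
      qed
      obtain z where "z \<in> insert y A" "z \<noteq> x" using False by auto
      from same[OF this] obtain x' v where v: "x' \<in> nodes G" "v \<in> nodes G"
        "{x, x'} = {v, par v}" "v \<in> ?C" by blast
      have vy: "below v x \<noteq> below v y" using v by (auto simp: cut_def)
      have "below v z \<noteq> below v x" if z: "z \<in> A - {x}" for z
      proof -
        obtain x'' w where w: "x'' \<in> nodes G" "w \<in> nodes G"
          "{x, x''} = {w, par w}" "w \<in> ?C" "below w x \<noteq> below w z"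
          using same[of z] z by blast
        have "below w x \<noteq> below w y" using w by (auto simp: cut_def)
        then have "v = w" using edge_towards_unique[OF v(3) w(3)] v w vy less.prems by blast
        then show ?thesis using w by auto
      qed
      then show ?thesis using that v by blast
    qed
    let ?A' = "A - {x}"
    let ?B' = "cut (insert x' (insert y ?A'))" and ?C' = "cut {x', y}"
    have finB': "finite ?B'" and finC': "finite ?C'"
      using less.prems v by (auto intro!: finite_cut)
    have eqs: "?B - {v} = ?B' - {v}" "?C - {v} = ?C' - {v}"
      using cut_move[OF v(3,2)] cut_pair_move[OF v(3,2)] by auto
    have opp: "below v x \<noteq> below v x'" using edge_below v by blast
    \<comment> \<open>A step into a side branch leaves the whole cut unchanged, since its edge now
      separates \<open>x'\<close> from \<open>y\<close>. A step towards \<open>y\<close> removes its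
      edge, since nothing remains behind. Both lower the measure by exactly one, and the inclusion
      keeps the rest of the walk on edges of the original cut.\<close>
    have main: "2 * card ?B + card ?C' = Suc (2 * card ?B' + card ?C)" "?B' \<subseteq> ?B" "v \<in> ?B"
      using choice
    proof (atomize (full), elim disjE conjE)
      assume "v \<in> ?B" "v \<notin> ?C"
      then have "v \<in> ?C'" using opp v(2) by (auto simp: cut_def)
      then have "?C' = insert v ?C" using eqs by auto
      then have "card ?C' = Suc (card ?C)" using \<open>v \<notin> ?C\<close> finC by simp
      moreover have "v \<in> ?B'" using \<open>v \<in> ?C'\<close> by (auto simp: cut_def)
      then have "?B = ?B'" using eqs \<open>v \<in> ?B\<close> by auto
      ultimately show "2 * card ?B + card ?C' = Suc (2 * card ?B' + card ?C) \<and> ?B' \<subseteq> ?B \<and> v \<in> ?B"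
        using \<open>v \<in> ?B\<close> by simp
    next
      assume "v \<in> ?C" and A: "\<forall>z\<in>A - {x}. below v z \<noteq> below v x"
      then have "v \<notin> ?C'" "v \<in> ?B" using opp by (auto simp: cut_def)
      moreover have "v \<notin> ?B'" using \<open>v \<in> ?C\<close> opp A by (auto simp: cut_def)
      ultimately have "?B = insert v ?B'" "?C = insert v ?C'" using eqs \<open>v \<in> ?C\<close> by auto
      then have "card ?B = Suc (card ?B')" "card ?C = Suc (card ?C')" "?B' \<subseteq> ?B"
        using finB' finC' \<open>v \<notin> ?B'\<close> \<open>v \<notin> ?C'\<close> by auto
      then show "2 * card ?B + card ?C' = Suc (2 * card ?B' + card ?C) \<and> ?B' \<subseteq> ?B \<and> v \<in> ?B"
        using \<open>v \<in> ?B\<close> by simp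
    qed
    have "?C' \<subseteq> ?B'" by (auto simp: cut_def)
    then have "card ?C' \<le> card ?B'" using finB' by (simp add: card_mono)
    then have "2 * card ?B' - card ?C' < 2 * card ?B - card ?C" using main CB by linarith
    from less.hyps[OF this] obtain p where p: "walk_between G x' p y" "?A' \<subseteq> set p"
      "successively (\<lambda>a b. {a, b} \<in> (\<lambda>v. {v, par v}) ` ?B') p"
      "length p + card ?C' = Suc (2 * card ?B')"
      using less.prems v by blast
    have "{x, x'} \<in> edges G" using v by (auto simp: edges_eq)
    then have "walk_between G x (x # p) y" by (rule walk_between_Cons[OF p(1) less.prems(1)])
    moreover have "A \<subseteq> set (x # p)" using p by auto
    moreover have "successively (\<lambda>a b. {a, b} \<in> (\<lambda>v. {v, par v}) ` ?B) p"
      by (rule successively_mono[OF p(3)]) (use main in auto)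
    then have "successively (\<lambda>a b. {a, b} \<in> (\<lambda>v. {v, par v}) ` ?B) (x # p)"
      using p(1) v(3) main(3) by (auto simp: successively_Cons walk_between_def)
    moreover have "length (x # p) + card ?C = Suc (2 * card ?B)" using p main by simp
    ultimately show ?thesis by - (intro exI[of _ "x # p"] conjI; assumption)
  qed
qed

section \<open>The subtree spanned by a finite set\<close>

text \<open>Remove the closing edge of a supposed cycle. Being simple with at least three vertices,
  \<open>p\<close> does not use that edge, so it joins the two ends without changing sides, although
  they lie on different sides.\<close>

lemma acyclic: "\<not> (walk G p \<and> distinct p \<and> length p \<ge> 3 \<and> {last p, hd p} \<in> edges G)"
proof
  assume p: "walk G p \<and> distinct p \<and> length p \<ge> 3 \<and> {last p, hd p} \<in> edges G"
  then obtain v where v: "v \<in> nodes G" "{last p, hd p} = {v, par v}" by (auto simp: edges_eq)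
  have "successively (\<lambda>a b. {a, b} \<in> edges G - {{v, par v}}) p"
    unfolding successively_conv_nth
  proof (intro allI impI)
    fix i assume i: "Suc i < length p"
    have "p \<noteq> []" using i by auto
    note ends = last_conv_nth[OF this] hd_conv_nth[OF this]
    have inj: "i = j" if "p ! i = p ! j" "i < length p" "j < length p" for i j
      using p that nth_eq_iff_index_eq by blast
    have "{p ! i, p ! Suc i} \<noteq> {last p, hd p}"
    proof
      assume "{p ! i, p ! Suc i} = {last p, hd p}"
      then consider "p ! i = p ! (length p - 1)" | "p ! i = p ! 0" "p ! Suc i = p ! (length p - 1)"
        unfolding ends doubleton_eq_iff by blast
      then show False
      proof cases
        case 1
        then have "i = length p - 1" using i by (intro inj) auto
        then show False using i by simp
      next
        case 2
        have "i = 0" using 2 i by (intro inj) auto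
        moreover have "Suc i = length p - 1" using 2 i by (intro inj) auto
        moreover have "length p \<ge> 3" using p by blast
        ultimately show False by linarith
      qed
    qed
    then show "{p ! i, p ! Suc i} \<in> edges G - {{v, par v}}"
      using p i v by (auto simp: walk_def successively_conv_nth)
  qed
  moreover have "last p \<in> set p" using p by (auto simp: walk_def)
  ultimately have "below v (last p) = below v (hd p)"
    using successively_below[of "edges G - {{v, par v}}" p v "last p"] v by auto
  then show False using edge_below v by blast
qed

text \<open>The subtree is read off an optimal closed walk through \<open>B\<close>, which uses cut
  edges only. It is smallest because a subtree containing \<open>B\<close> joins two points of
  \<open>B\<close> on different sides of any given cut edge, and so must contain that edge.\<close>

lemma smallest_subtree_edges:
  assumes "finite B" "B \<subseteq> nodes G" "B \<noteq> {}"
  shows "edges (smallest_subtree G B) = (\<lambda>v. {v, par v}) ` cut B"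
proof -
  obtain x where x: "x \<in> B" using assms by auto
  let ?F = "(\<lambda>v. {v, par v}) ` cut B"
  have "insert x B = B" using x by auto
  then obtain p where p: "walk_between G x p x" "B \<subseteq> set p"
    "successively (\<lambda>a b. {a, b} \<in> ?F) p"
    using optimal_walk_exists[of x x B] assms x by auto
  have FG: "?F \<subseteq> edges G" by (auto simp: edges_eq cut_def)
  have "e \<subseteq> set p" if e: "e \<in> ?F" for e
  proof -
    \<comment> \<open>Both ends of every edge used by \<open>p\<close> lie on \<open>p\<close>.
      Since \<open>p\<close> must cross every cut edge, this holds for all of them.\<close>
    let ?F' = "{e \<in> ?F. e \<subseteq> set p}"
    have "successively (\<lambda>a b. {a, b} \<in> ?F') p"
      by (rule successively_mono[OF successively_set[OF p(3)]]) auto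
    then have "e \<in> ?F'"
      using cut_crossed[of ?F' p _ B] e p(2) FG by blast
    then show ?thesis by auto
  qed
  then have Fp: "\<Union> ?F \<subseteq> set p" by auto
  let ?H = "\<lparr>nodes = set p, edges = ?F\<rparr>"
  have sub: "subgraph ?H G"
    using p Fp FG by (auto simp: subgraph_def walk_between_def walk_def)
  have "walk ?H p" using p by (auto simp: walk_between_def walk_def)
  then have conn: "\<exists>r. walk_between ?H a r b" if "a \<in> set p" "b \<in> set p" for a b
    using walk_connects[of ?H p a b] that by blast
  have "walk G r" if r: "walk ?H r" for r
  proof -
    have "successively (\<lambda>a b. {a, b} \<in> edges G) r"
      by (rule successively_mono[of "\<lambda>a b. {a, b} \<in> edges ?H"]) (use r FG in \<open>auto simp: walk_def\<close>)
    then show ?thesis using r sub by (auto simp: walk_def subgraph_def)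
  qed
  then have "\<not> (\<exists>r. walk ?H r \<and> distinct r \<and> length r \<ge> 3 \<and> {last r, hd r} \<in> edges ?H)"
    using acyclic subsetD[OF FG] unfolding ugraph.select_convs by blast
  then have "subtree ?H G"
    using sub conn p unfolding subtree_def is_tree_def by (auto simp: walk_between_def walk_def)
  moreover have "subgraph ?H H'" if H': "subtree H' G" "B \<subseteq> nodes H'" for H'
  proof -
    have "{v, par v} \<in> edges H'" if v: "v \<in> cut B" for v
    proof -
      obtain a b where ab: "a \<in> B" "b \<in> B" "below v a" "\<not> below v b"
        using v by (auto simp: cut_def)
      obtain r where r: "walk_between H' a r b"
        using H' ab unfolding subtree_def is_tree_def by blast
      have "a \<in> set r" "b \<in> set r" using r by (auto simp: walk_between_def walk_def)
      moreover have "v \<in> cut {a, b}" using ab v by (auto simp: cut_def)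
      ultimately show ?thesis
        using cut_crossed[of "edges H'" r v "{a, b}"] r H'
        by (auto simp: walk_between_def walk_def subtree_def subgraph_def)
    qed
    then have F: "?F \<subseteq> edges H'" by auto
    moreover have "\<Union> ?F \<subseteq> nodes H'" 
      using Union_mono[OF F] H' unfolding subtree_def subgraph_def by blast
    then have "set p \<subseteq> nodes H'"
      using p x H' by (intro successively_subset[OF p(3)]) (auto simp: walk_between_def walk_def)
    ultimately show ?thesis using Fp by (auto simp: subgraph_def)
  qed
  ultimately have "smallest_subtree G B = ?H"
    using p by (intro smallest_subtree_eq) auto
  then show ?thesis by simp
qed

lemma card_edges_smallest_subtree:
  assumes "finite B" "B \<subseteq> nodes G" "B \<noteq> {}"
  shows "card (edges (smallest_subtree G B)) = card (cut B)"
proof -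
  have "inj_on (\<lambda>v. {v, par v}) (cut B)"
    by (rule inj_onI, rule edge_inj) (simp_all add: cut_def)
  then show ?thesis unfolding smallest_subtree_edges[OF assms] by (rule card_image)
qed

section \<open>The travelling salesman formula\<close>

lemma TSP_eq:
  assumes "x \<in> nodes G" "y \<in> nodes G" "finite A" "A \<subseteq> nodes G"
  shows "TSP G A x y + card (cut {x, y}) = 2 * card (cut (insert x (insert y A)))"
    and "\<exists>p. walk_between G x p y \<and> A \<subseteq> set p \<and> length p = Suc (TSP G A x y)"
proof -
  let ?P = "\<lambda>n. \<exists>p. walk_between G x p y \<and> A \<subseteq> set p \<and> length p = Suc n"
  obtain p where p: "walk_between G x p y" "A \<subseteq> set p"
    "length p + card (cut {x, y}) = Suc (2 * card (cut (insert x (insert y A))))"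
    using optimal_walk_exists[OF assms] by blast
  have "length p \<noteq> 0" using p by (auto simp: walk_between_def walk_def)
  then obtain n where n: "length p = Suc n" by (cases "length p") auto
  have least: "n \<le> m" if "?P m" for m
  proof -
    from that obtain r where "walk_between G x r y" "A \<subseteq> set r" "length r = Suc m" by blast
    from walk_length_ge[OF this(1,2) assms(3)] this(3) show ?thesis using p(3) n by simp
  qed
  have "TSP G A x y = n"
    unfolding TSP_def by (rule Least_equality) (use p n least in auto)
  then show "TSP G A x y + card (cut {x, y}) = 2 * card (cut (insert x (insert y A)))" "?P (TSP G A x y)"
    using p n by auto
qed

text \<open>A distance is a travelling salesman length with nothing to visit; the two cuts then
  coincide.\<close>

lemma graph_dist_eq:
  assumes "x \<in> nodes G" "y \<in> nodes G"
  shows "graph_dist G x y = card (cut {x, y})"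
  using TSP_eq(1)[OF assms, of "{}"] by (simp add: TSP_def graph_dist_def)

theorem TSP_smallest_subtree:
  assumes "x \<in> nodes G" "y \<in> nodes G" "finite A" "A \<subseteq> nodes G"
  shows "int (TSP G A x y) =
    2 * int (card (edges (smallest_subtree G (A \<union> {x, y})))) - int (graph_dist G x y)"
proof -
  have "A \<union> {x, y} = insert x (insert y A)" by auto
  then show ?thesis
    using TSP_eq(1)[OF assms] assms by (simp add: graph_dist_eq card_edges_smallest_subtree)
qed

lemma TSP_le:
  assumes "walk_between G x p y" "A \<subseteq> set p" "length p = Suc n"
  shows "TSP G A x y \<le> n"
  unfolding TSP_def by (rule Least_le) (use assms in auto)

end

section \<open>The tree with its affine group\<close>

lemma nodes_Tr_iff:
  "(m, u) \<in> nodes (Tr q) \<longleftrightarrow>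
     (\<forall>k\<le>m. u k < q) \<and> (\<forall>k>m. u k = 0) \<and> (\<exists>N. \<forall>k\<le>N. u k = 0)"
  by (auto simp: Tr_def level_set_def)

lemma edges_Tr: "edges (Tr q) = (\<lambda>v. {v, ancestor v}) ` nodes (Tr q)"
  by (auto simp: Tr_def)

lemma edges_Tr_iff:
  "{x, y} \<in> edges (Tr q) \<longleftrightarrow>
     (x \<in> nodes (Tr q) \<and> y = ancestor x) \<or> (y \<in> nodes (Tr q) \<and> x = ancestor y)"
  by (auto simp: edges_Tr doubleton_eq_iff image_iff)

lemma fst_ancestor: "fst (ancestor v) = fst v - 1"
  by (cases v) (simp add: ancestor_def)

lemma ancestor_nodes: "v \<in> nodes (Tr q) \<Longrightarrow> ancestor v \<in> nodes (Tr q)"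
proof (cases v)
  case (Pair m u)
  assume "v \<in> nodes (Tr q)"
  then obtain N where "\<forall>k\<le>N. u k = 0" "\<forall>k\<le>m. u k < q" "\<forall>k>m. u k = 0"
    by (auto simp: Pair nodes_Tr_iff)
  then show ?thesis by (auto simp: Pair ancestor_def nodes_Tr_iff intro!: exI[of _ N])
qed

lemma child_nodes:
  assumes "v \<in> nodes (Tr q)" "t < q"
  shows "child v t \<in> nodes (Tr q)"
proof (cases v)
  case (Pair m u)
  from assms obtain N where "\<forall>k\<le>N. u k = 0" "\<forall>k\<le>m. u k < q" "\<forall>k>m. u k = 0"
    by (auto simp: Pair nodes_Tr_iff)
  \<comment> \<open>The appended entry at \<open>m + 1\<close> may be nonzero, hence the bound
    \<open>min N m\<close>.\<close>
  then show ?thesis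
    using assms by (auto simp: Pair child_def nodes_Tr_iff intro!: exI[of _ "min N m"])
qed

lemma ancestor_child: "v \<in> nodes (Tr q) \<Longrightarrow> ancestor (child v t) = v"
  by (cases v) (auto simp: ancestor_def child_def nodes_Tr_iff)

lemma child_ancestor: "child (ancestor v) (snd v (fst v)) = v"
  by (cases v) (simp add: ancestor_def child_def)

lemma child_inject: "child v s = child v t \<longleftrightarrow> s = t"
  by (cases v) (auto simp: child_def dest: fun_upd_eqD)

lemma nodes_childE:
  assumes "v \<in> nodes (Tr q)"
  obtains t where "t < q" "v = child (ancestor v) t"
proof
  show "snd v (fst v) < q" using assms by (cases v) (auto simp: nodes_Tr_iff)
qed (simp add: child_ancestor)

lemma ancestor_omega: "ancestor (\<omega> n) = \<omega> (Suc n)"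
  by (auto simp: ancestor_def \<omega>_def)

lemma funpow_ancestor_omega: "(ancestor ^^ n) (\<omega> k) = \<omega> (k + n)"
  by (induction n) (auto simp: ancestor_omega)

lemma fst_omega: "fst (\<omega> n) = - int n"
  by (simp add: \<omega>_def)

lemma funpow_ancestor:
  assumes "(m, u) \<in> nodes (Tr q)"
  shows "(ancestor ^^ n) (m, u) = (m - int n, \<lambda>k. if k \<le> m - int n then u k else 0)"
proof (induction n)
  case 0
  then show ?case using assms by (auto simp: nodes_Tr_iff)
next
  case (Suc n)
  then show ?case by (auto simp: ancestor_def)
qed

lemma ancestors_reach_omega:
  assumes "v \<in> nodes (Tr q)"
  obtains n k where "(ancestor ^^ n) v = \<omega> k"
proof -
  obtain m u where v: "v = (m, u)" by (cases v)
  from assms obtain N where N: "\<forall>k\<le>N. u k = 0" by (auto simp: v nodes_Tr_iff)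
  \<comment> \<open>Level \<open>m - int n\<close> must be at most \<open>N\<close>, so that only
    zeros remain, and at most \<open>0\<close>, so that the vertex has a natural index on the
    ray.\<close>
  define n where "n = nat (max m (m - N))"
  have "m - int n \<le> N" "m - int n \<le> 0" by (auto simp: n_def)
  then have "(ancestor ^^ n) v = \<omega> (nat (int n - m))"
    using N assms by (auto simp: v funpow_ancestor \<omega>_def)
  then show ?thesis by (rule that)
qed

section \<open>Automorphisms fixing the end\<close>

locale affine_tree =
  fixes q :: nat
  assumes q_pos: "0 < q"
begin

abbreviation V :: "vertex set" where
  "V \<equiv> nodes (Tr q)"

lemma omega_nodes: "\<omega> n \<in> V"
  using q_pos by (simp add: \<omega>_def nodes_Tr_iff)

sublocale tree_with_end "Tr q" ancestor fst
proof
  fix x y assume "x \<in> V" "y \<in> V"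
  then obtain m k n l where "(ancestor ^^ m) x = \<omega> k" "(ancestor ^^ n) y = \<omega> l"
    by (metis ancestors_reach_omega)
  \<comment> \<open>Climbing on from each ray vertex by the index of the other leads both to
    \<open>\<omega> (k + l)\<close>.\<close>
  then have "(ancestor ^^ (l + m)) x = (ancestor ^^ (k + n)) y"
    by (simp add: funpow_add funpow_ancestor_omega add.commute)
  then show "\<exists>m n. (ancestor ^^ m) x = (ancestor ^^ n) y" by blast
qed (auto simp: edges_Tr ancestor_nodes fst_ancestor)

text \<open>The identity holds far up on the ray towards the end.  If it holds for the ancestor of \<open>v\<close>,
  it holds for \<open>v\<close>, as otherwise \<open>g\<close> would send \<open>v\<close> and its grandparent to the same vertex.\<close>

lemma Aff_commutes_ancestor:
  assumes g: "g \<in> carrier (Aff q)" and v: "v \<in> V"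
  shows "g (ancestor v) = ancestor (g v)"
proof -
  let ?P = "\<lambda>v. g (ancestor v) = ancestor (g v)"
  have perm: "g permutes V" and aut: "automorphism (Tr q) g"
    using g by (auto simp: Aff_def automorphism_def)
  have step: "?P x" if "x \<in> V" "?P (ancestor x)" for x
  proof (rule ccontr)
    assume "\<not> ?P x"
    have "{x, ancestor x} \<in> edges (Tr q)" using that by (simp add: edges_Tr)
    then have "{g x, g (ancestor x)} \<in> edges (Tr q)"
      using aut that ancestor_nodes unfolding automorphism_def by blast
    with \<open>\<not> ?P x\<close> have "g x = g (ancestor (ancestor x))" using that(2) by (auto simp: edges_Tr_iff)
    then have "x = ancestor (ancestor x)" using permutes_inj[OF perm] by (auto dest: injD)
    then have "fst x = fst x - 2" by (metis fst_ancestor diff_diff_eq one_add_one)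
    then show False by simp
  qed
  have down: "?P x" if "x \<in> V" "?P ((ancestor ^^ n) x)" for n x
    using that
  proof (induction n arbitrary: x)
    case (Suc n)
    then have "?P (ancestor x)" using ancestor_nodes by (auto simp: funpow_swap1)
    then show ?case using step Suc by blast
  qed auto
  obtain n k where n: "(ancestor ^^ n) v = \<omega> k" using ancestors_reach_omega v by blast
  obtain i j where ij: "\<And>n. g (\<omega> (i + n)) = \<omega> (j + n)"
    using g by (auto simp: Aff_def same_end_def)
  \<comment> \<open>The condition on ends describes \<open>g\<close> only from index
    \<open>i\<close> of the ray on, hence \<open>i\<close> additional steps up.\<close>
  have "(ancestor ^^ (i + n)) v = \<omega> (i + k)"
    by (simp add: funpow_add n funpow_ancestor_omega add.commute)
  moreover have "?P (\<omega> (i + k))"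
    using ij[of k] ij[of "Suc k"] by (simp add: ancestor_omega)
  ultimately have "?P ((ancestor ^^ (i + n)) v)" by simp
  then show ?thesis by (rule down[OF v])
qed

lemma commutes_funpow:
  assumes "\<And>v. v \<in> V \<Longrightarrow> g (ancestor v) = ancestor (g v)" "v \<in> V"
  shows "g ((ancestor ^^ n) v) = (ancestor ^^ n) (g v)"
  using assms(2) by (induction n) (simp_all add: assms(1) funpow_nodes)

text \<open>Replaces edges and ends by one equation, which makes the group laws easy. For the
  converse, edges are pairs of a vertex and its ancestor, and the image of the origin climbs to the
  ray, so the image of the ray eventually runs along it.\<close>

lemma Aff_iff:
  "g \<in> carrier (Aff q) \<longleftrightarrow> g permutes V \<and> (\<forall>v\<in>V. g (ancestor v) = ancestor (g v))"
proof
  assume "g \<in> carrier (Aff q)"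
  then show "g permutes V \<and> (\<forall>v\<in>V. g (ancestor v) = ancestor (g v))"
    using Aff_commutes_ancestor by (auto simp: Aff_def automorphism_def)
next
  assume g: "g permutes V \<and> (\<forall>v\<in>V. g (ancestor v) = ancestor (g v))"
  then have inj: "g x = g y \<longleftrightarrow> x = y" and inV: "g x \<in> V \<longleftrightarrow> x \<in> V" for x y
    by (auto simp: permutes_in_image dest: permutes_inj injD)
  have "{g x, g y} \<in> edges (Tr q) \<longleftrightarrow> {x, y} \<in> edges (Tr q)" if "x \<in> V" "y \<in> V" for x y
    using g that inj[of y "ancestor x"] inj[of x "ancestor y"] inV by (auto simp: edges_Tr_iff)
  moreover obtain n k where "(ancestor ^^ n) (g origin) = \<omega> k"
    using ancestors_reach_omega inV omega_nodes by blast
  then have "g (\<omega> (n + m)) = \<omega> (k + m)" for m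
    using commutes_funpow[of g origin "m + n"] g omega_nodes
    by (simp add: funpow_ancestor_omega funpow_add add.commute)
  then have "same_end (g \<circ> \<omega>) \<omega>" by (auto simp: same_end_def)
  ultimately show "g \<in> carrier (Aff q)" using g by (auto simp: Aff_def automorphism_def)
qed

lemma Aff_permutes: "g \<in> carrier (Aff q) \<Longrightarrow> g permutes V"
  by (simp add: Aff_iff)

lemma Aff_nodes: "g \<in> carrier (Aff q) \<Longrightarrow> g v \<in> V \<longleftrightarrow> v \<in> V"
  by (rule permutes_in_image[OF Aff_permutes])

lemma Aff_inject: "g \<in> carrier (Aff q) \<Longrightarrow> g v = g w \<longleftrightarrow> v = w"
  by (rule inj_eq[OF permutes_inj[OF Aff_permutes]])

lemma Aff_edge:
  assumes "g \<in> carrier (Aff q)" "{x, y} \<in> edges (Tr q)"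
  shows "{g x, g y} \<in> edges (Tr q)"
  using assms(2) unfolding edges_Tr_iff
  by (elim disjE conjE) (simp_all add: Aff_commutes_ancestor[OF assms(1)] Aff_nodes[OF assms(1)])

lemma mult_Aff: "g \<otimes>\<^bsub>Aff q\<^esub> h = h \<circ> g"
  by (simp add: Aff_def)

lemma one_Aff: "\<one>\<^bsub>Aff q\<^esub> = id"
  by (simp add: Aff_def)

lemma inv_fun_Aff:
  assumes g: "g \<in> carrier (Aff q)"
  shows "Hilbert_Choice.inv g \<in> carrier (Aff q)"
  unfolding Aff_iff
proof (intro conjI ballI)
  let ?i = "Hilbert_Choice.inv g"
  note perm = Aff_permutes[OF g]
  show perm': "?i permutes V" by (rule permutes_inv[OF perm])
  fix v assume v: "v \<in> V"
  have iv: "?i v \<in> V" using v perm' by (simp add: permutes_in_image)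
  have "?i (ancestor v) = ?i (g (ancestor (?i v)))"
    using Aff_commutes_ancestor[OF g iv] permutes_inverses(1)[OF perm] by simp
  then show "?i (ancestor v) = ancestor (?i v)"
    using permutes_inverses(2)[OF perm] by simp
qed

sublocale Aff: group "Aff q"
proof (rule groupI)
  fix x y assume "x \<in> carrier (Aff q)" "y \<in> carrier (Aff q)"
  then show "x \<otimes>\<^bsub>Aff q\<^esub> y \<in> carrier (Aff q)"
    by (auto simp: mult_Aff Aff_iff permutes_compose permutes_in_image)
next
  show "\<one>\<^bsub>Aff q\<^esub> \<in> carrier (Aff q)" by (simp add: one_Aff Aff_iff permutes_id)
next
  fix x assume x: "x \<in> carrier (Aff q)"
  then have "Hilbert_Choice.inv x \<otimes>\<^bsub>Aff q\<^esub> x = \<one>\<^bsub>Aff q\<^esub>"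
    using permutes_inv_o(1)[OF Aff_permutes] by (simp add: mult_Aff one_Aff)
  with inv_fun_Aff[OF x] show "\<exists>y\<in>carrier (Aff q). y \<otimes>\<^bsub>Aff q\<^esub> x = \<one>\<^bsub>Aff q\<^esub>" by blast
qed (auto simp: mult_Aff one_Aff)

subsection \<open>The height homomorphism and the shift\<close>

text \<open>The change of level is the same at a vertex and at its ancestors, and every vertex
  climbs to the ray, as the origin does. This constancy justifies the definite description in
  \<open>\<Phi>\<close>.\<close>

lemma fst_Aff:
  assumes g: "g \<in> carrier (Aff q)" and v: "v \<in> V"
  shows "fst (g v) = fst v + \<Phi> q g"
proof -
  have up: "fst (g ((ancestor ^^ n) w)) - fst ((ancestor ^^ n) w) = fst (g w) - fst w"
    if "w \<in> V" for n w
    using that g commutes_funpow[of g w n] h_funpow[of w n] h_funpow[of "g w" n]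
    by (simp add: Aff_commutes_ancestor Aff_nodes)
  have const: "fst (g w) - fst w = fst (g origin) - fst origin" if w: "w \<in> V" for w
  proof -
    obtain n k where n: "(ancestor ^^ n) w = \<omega> k" using ancestors_reach_omega w by blast
    show ?thesis
      using up[OF w, of n] up[OF omega_nodes, of k 0] n by (simp add: funpow_ancestor_omega)
  qed
  have "\<Phi> q g = fst (g origin) - fst origin"
    unfolding \<Phi>_def
  proof (rule the_equality)
    show "\<forall>w\<in>V. fst (g w) - fst w = fst (g origin) - fst origin" by (intro ballI const)
    show "m = fst (g origin) - fst origin" if "\<forall>w\<in>V. fst (g w) - fst w = m" for m
      using bspec[OF that omega_nodes[of 0]] by (rule sym)
  qed
  then show ?thesis using const[OF v] by simp
qed

lemma Phi_eqI:
  assumes "g \<in> carrier (Aff q)" "fst (g v) = fst v + m" "v \<in> V"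
  shows "\<Phi> q g = m"
  using fst_Aff[of g v] assms by simp

lemma Phi_mult:
  assumes "g \<in> carrier (Aff q)" "h \<in> carrier (Aff q)"
  shows "\<Phi> q (g \<otimes>\<^bsub>Aff q\<^esub> h) = \<Phi> q g + \<Phi> q h"
proof (rule Phi_eqI[OF _ _ omega_nodes])
  show "fst ((g \<otimes>\<^bsub>Aff q\<^esub> h) origin) = fst origin + (\<Phi> q g + \<Phi> q h)"
    using assms fst_Aff[of h "g origin"] fst_Aff[of g origin]
    by (simp add: mult_Aff Aff_nodes omega_nodes)
qed (use assms in simp)

lemma Phi_one: "\<Phi> q \<one>\<^bsub>Aff q\<^esub> = 0"
  by (rule Phi_eqI[OF Aff.one_closed _ omega_nodes[of 0]]) (simp add: one_Aff)

lemma alpha_Aff: "\<alpha> q \<in> carrier (Aff q)"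
  unfolding Aff_iff
proof (intro conjI ballI)
  let ?b = "\<lambda>v. (fst v - 1, \<lambda>k. snd v (k + 1)) :: vertex"
  have a: "\<alpha> q v \<in> V" "?b v \<in> V" if v: "v \<in> V" for v
  proof -
    obtain m u where mu: "v = (m, u)" by (cases v)
    from v obtain N where N: "\<forall>k\<le>N. u k = 0" by (auto simp: mu nodes_Tr_iff)
    show "\<alpha> q v \<in> V"
      using v N by (auto simp: mu \<alpha>_def nodes_Tr_iff intro!: exI[of _ "N + 1"])
    show "?b v \<in> V"
      using v N by (auto simp: mu nodes_Tr_iff intro!: exI[of _ "N - 1"])
  qed
  have "bij_betw (\<alpha> q) V V"
    by (rule bij_betw_byWitness[of _ ?b]) (use a in \<open>auto simp: \<alpha>_def[of q] split: if_splits\<close>)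
  then show "\<alpha> q permutes V" by (rule bij_imp_permutes) (simp add: \<alpha>_def)
  fix v assume "v \<in> V"
  then show "\<alpha> q (ancestor v) = ancestor (\<alpha> q v)"
    using ancestor_nodes[of v q] by (cases v) (auto simp: \<alpha>_def ancestor_def)
qed

lemma alpha_child: "v \<in> V \<Longrightarrow> t < q \<Longrightarrow> \<alpha> q (child v t) = child (\<alpha> q v) t"
  using child_nodes[of v q t] by (cases v) (auto simp: \<alpha>_def child_def)

lemma Phi_alpha: "\<Phi> q (\<alpha> q) = 1"
  by (rule Phi_eqI[OF alpha_Aff _ omega_nodes[of 0]]) (simp add: \<alpha>_def omega_nodes)

lemma Phi_alpha_pow: "\<Phi> q (\<alpha> q [^]\<^bsub>Aff q\<^esub> (m :: int)) = m"
proof -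
  have nat: "\<Phi> q (\<alpha> q [^]\<^bsub>Aff q\<^esub> n) = int n" for n :: nat
    by (induction n) (auto simp: Phi_one Phi_mult Phi_alpha alpha_Aff)
  have inv: "\<Phi> q (inv\<^bsub>Aff q\<^esub> g) = - \<Phi> q g" if "g \<in> carrier (Aff q)" for g
    using Phi_mult[of g "inv\<^bsub>Aff q\<^esub> g"] that by (simp add: Phi_one)
  show ?thesis
    by (cases m rule: int_cases2)
      (auto simp: int_pow_int nat inv alpha_Aff Aff.int_pow_neg)
qed

subsection \<open>Portraits\<close>

lemma hor_portrait_eqI:
  assumes "\<sigma> \<in> Sym q" "\<And>t. t < q \<Longrightarrow> g (child v t) = child (g v) (\<sigma> t)"
  shows "hor_portrait q g v = \<sigma>"
  unfolding hor_portrait_def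
proof (rule the_equality)
  fix \<tau> assume \<tau>: "\<tau> \<in> Sym q \<and> (\<forall>t<q. g (child v t) = child (g v) (\<tau> t))"
  show "\<tau> = \<sigma>"
  proof
    fix t
    show "\<tau> t = \<sigma> t"
    proof (cases "t < q")
      case True
      then have "child (g v) (\<tau> t) = child (g v) (\<sigma> t)" using \<tau> assms(2)[of t] by simp
      then show ?thesis by (simp add: child_inject)
    next
      case False
      then show ?thesis using \<tau> assms(1) permutes_not_in[of \<tau> "{..<q}" t]
        permutes_not_in[of \<sigma> "{..<q}" t] by simp
    qed
  qed
qed (use assms in simp)

text \<open>Commuting with \<open>ancestor\<close> sends children of \<open>v\<close> to children of
  \<open>g v\<close>, injectively and hence bijectively. The height shift does not matter, so labels
  can be read off \<open>g\<close> itself.\<close>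

lemma hor_portrait_spec:
  assumes g: "g \<in> carrier (Aff q)" and v: "v \<in> V"
  shows "hor_portrait q g v \<in> Sym q"
    and "t < q \<Longrightarrow> g (child v t) = child (g v) (hor_portrait q g v t)"
proof -
  have "\<exists>s<q. g (child v t) = child (g v) s" if "t < q" for t
  proof -
    have c: "child v t \<in> V" using child_nodes v that .
    then have "g (child v t) \<in> V" using g by (simp add: Aff_nodes)
    then obtain s where "s < q" "g (child v t) = child (ancestor (g (child v t))) s"
      by (rule nodes_childE)
    moreover have "ancestor (g (child v t)) = g v"
      using Aff_commutes_ancestor[OF g c] ancestor_child[OF v] by simp
    ultimately show ?thesis by auto
  qed
  then obtain s where s: "\<And>t. t < q \<Longrightarrow> s t < q \<and> g (child v t) = child (g v) (s t)" by metis
  \<comment> \<open>The identity beyond \<open>q\<close> is what \<open>permutes\<close>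
    demands.\<close>
  define \<sigma> where "\<sigma> t = (if t < q then s t else t)" for t
  have "inj_on \<sigma> {..<q}"
  proof (rule inj_onI)
    fix a b assume ab: "a \<in> {..<q}" "b \<in> {..<q}" "\<sigma> a = \<sigma> b"
    then have "g (child v a) = g (child v b)" using s[of a] s[of b] by (simp add: \<sigma>_def)
    then show "a = b" by (simp add: Aff_inject[OF g] child_inject)
  qed
  moreover have "\<sigma> ` {..<q} \<subseteq> {..<q}" using s by (auto simp: \<sigma>_def)
  ultimately have "bij_betw \<sigma> {..<q} {..<q}"
    by (simp add: bij_betw_def endo_inj_surj)
  then have "\<sigma> permutes {..<q}" by (rule bij_imp_permutes) (simp add: \<sigma>_def)
  moreover have "g (child v t) = child (g v) (\<sigma> t)" if "t < q" for t
    using s[OF that] that by (simp add: \<sigma>_def)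
  moreover from calculation have "hor_portrait q g v = \<sigma>" by (intro hor_portrait_eqI) auto
  ultimately show "hor_portrait q g v \<in> Sym q"
    and "t < q \<Longrightarrow> g (child v t) = child (g v) (hor_portrait q g v t)" by auto
qed

lemma Sym_less: "\<sigma> \<in> Sym q \<Longrightarrow> \<sigma> t < q \<longleftrightarrow> t < q"
  using permutes_in_image[of \<sigma> "{..<q}" t] by simp

lemma hor_portrait_mult:
  assumes "g \<in> carrier (Aff q)" "h \<in> carrier (Aff q)" "v \<in> V"
  shows "hor_portrait q (g \<otimes>\<^bsub>Aff q\<^esub> h) v = hor_portrait q h (g v) \<circ> hor_portrait q g v"
proof (rule hor_portrait_eqI)
  have gv: "g v \<in> V" using assms by (simp add: Aff_nodes)
  note g = hor_portrait_spec[OF assms(1,3)] and h = hor_portrait_spec[OF assms(2) gv]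
  show "hor_portrait q h (g v) \<circ> hor_portrait q g v \<in> Sym q"
    using g(1) h(1) by (simp add: permutes_compose)
  show "(g \<otimes>\<^bsub>Aff q\<^esub> h) (child v t) =
      child ((g \<otimes>\<^bsub>Aff q\<^esub> h) v) ((hor_portrait q h (g v) \<circ> hor_portrait q g v) t)" if "t < q" for t
    using that g h Sym_less[OF g(1)] by (simp add: mult_Aff)
qed

lemma hor_portrait_one: "hor_portrait q \<one>\<^bsub>Aff q\<^esub> v = id"
  by (rule hor_portrait_eqI) (simp_all add: one_Aff permutes_id)

lemma inv_Aff: "g \<in> carrier (Aff q) \<Longrightarrow> (inv\<^bsub>Aff q\<^esub> g) (g v) = v"
  "g \<in> carrier (Aff q) \<Longrightarrow> g ((inv\<^bsub>Aff q\<^esub> g) v) = v"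
  using Aff.r_inv[of g] Aff.l_inv[of g] by (simp_all add: mult_Aff one_Aff o_def id_def) metis+

lemma hor_portrait_alpha_pow:
  assumes "v \<in> V"
  shows "hor_portrait q (\<alpha> q [^]\<^bsub>Aff q\<^esub> (m :: int)) v = id"
proof -
  have a: "hor_portrait q (\<alpha> q) v = id" if "v \<in> V" for v
    by (rule hor_portrait_eqI) (simp_all add: alpha_child that permutes_id)
  have nat: "hor_portrait q (\<alpha> q [^]\<^bsub>Aff q\<^esub> n) v = id" if "v \<in> V" for n :: nat and v
    using that
    by (induction n)
      (simp_all add: hor_portrait_one hor_portrait_mult alpha_Aff a Aff_nodes)
  have inv: "hor_portrait q (inv\<^bsub>Aff q\<^esub> g) v = id"
    if g: "g \<in> carrier (Aff q)" and "\<And>v. v \<in> V \<Longrightarrow> hor_portrait q g v = id" for g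
  proof -
    have "(inv\<^bsub>Aff q\<^esub> g) v \<in> V" using g assms by (simp add: Aff_nodes)
    then show ?thesis
      using hor_portrait_mult[of g "inv\<^bsub>Aff q\<^esub> g" "(inv\<^bsub>Aff q\<^esub> g) v"] that
      by (simp add: hor_portrait_one inv_Aff)
  qed
  show ?thesis
    by (cases m rule: int_cases2)
      (simp_all add: int_pow_int nat inv alpha_Aff Aff.int_pow_neg assms)
qed

text \<open>The height shift of a horocyclic factor is zero, so \<open>\<Phi> q g\<close> is the
  only possible exponent of the shift.\<close>

lemma hor_part_eq:
  assumes g: "g \<in> carrier (Aff q)"
  shows "hor_part q g = g \<otimes>\<^bsub>Aff q\<^esub> \<alpha> q [^]\<^bsub>Aff q\<^esub> (- \<Phi> q g)"
  unfolding hor_part_def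
proof (rule the_equality)
  let ?a = "\<lambda>m :: int. \<alpha> q [^]\<^bsub>Aff q\<^esub> m"
  have a: "?a m \<in> carrier (Aff q)" for m by (simp add: alpha_Aff)
  have cancel: "h \<otimes>\<^bsub>Aff q\<^esub> ?a m \<otimes>\<^bsub>Aff q\<^esub> ?a (- m) = h" if "h \<in> carrier (Aff q)" for h m
    using that by (simp add: Aff.m_assoc alpha_Aff Aff.int_pow_neg)
  show "g \<otimes>\<^bsub>Aff q\<^esub> ?a (- \<Phi> q g) \<in> Hor q \<and>
    (\<exists>m. g = g \<otimes>\<^bsub>Aff q\<^esub> ?a (- \<Phi> q g) \<otimes>\<^bsub>Aff q\<^esub> ?a m)"
  proof
    show "g \<otimes>\<^bsub>Aff q\<^esub> ?a (- \<Phi> q g) \<in> Hor q"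
      using g a by (simp add: Hor_def Phi_mult Phi_alpha_pow)
    show "\<exists>m. g = g \<otimes>\<^bsub>Aff q\<^esub> ?a (- \<Phi> q g) \<otimes>\<^bsub>Aff q\<^esub> ?a m"
      using cancel[OF g, of "- \<Phi> q g"] by (intro exI[of _ "\<Phi> q g"]) simp
  qed
  fix \<gamma> assume "\<gamma> \<in> Hor q \<and> (\<exists>m. g = \<gamma> \<otimes>\<^bsub>Aff q\<^esub> ?a m)"
  then obtain m where \<gamma>: "\<gamma> \<in> carrier (Aff q)" "\<Phi> q \<gamma> = 0" "g = \<gamma> \<otimes>\<^bsub>Aff q\<^esub> ?a m"
    by (auto simp: Hor_def)
  then have "m = \<Phi> q g" using a by (simp add: Phi_mult Phi_alpha_pow)
  then show "\<gamma> = g \<otimes>\<^bsub>Aff q\<^esub> ?a (- \<Phi> q g)" using \<gamma> cancel[of \<gamma> m] by simp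
qed

text \<open>The shift preserves the last entry of each child, so its powers carry trivial labels and
  splitting them off changes nothing.\<close>

lemma portrait_eq:
  assumes "g \<in> carrier (Aff q)" "v \<in> V"
  shows "portrait q g v = hor_portrait q g v"
  using assms
  by (simp add: portrait_def hor_part_eq hor_portrait_mult hor_portrait_alpha_pow alpha_Aff Aff_nodes)

lemma portrait_spec:
  assumes "g \<in> carrier (Aff q)" "v \<in> V"
  shows "portrait q g v \<in> Sym q"
    and "t < q \<Longrightarrow> g (child v t) = child (g v) (portrait q g v t)"
  using hor_portrait_spec[OF assms] by (simp_all add: portrait_eq[OF assms])

lemma portrait_mult:
  assumes "g \<in> carrier (Aff q)" "h \<in> carrier (Aff q)" "v \<in> V"
  shows "portrait q (g \<otimes>\<^bsub>Aff q\<^esub> h) v = portrait q h (g v) \<circ> portrait q g v"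
  using assms by (simp add: portrait_eq hor_portrait_mult Aff_nodes)

lemma portrait_mult_alpha_pow:
  assumes "g \<in> carrier (Aff q)" "v \<in> V"
  shows "portrait q (g \<otimes>\<^bsub>Aff q\<^esub> \<alpha> q [^]\<^bsub>Aff q\<^esub> (m :: int)) v = portrait q g v"
  using assms
  by (simp add: portrait_eq hor_portrait_mult hor_portrait_alpha_pow alpha_Aff Aff_nodes)

text \<open>Elements with the same height shift agree far up on the ray towards the end, and from
  there the portrait determines the images of all descendants.\<close>

lemma Aff_eqI:
  assumes g: "g \<in> carrier (Aff q)" and h: "h \<in> carrier (Aff q)"
    and Phi: "\<Phi> q g = \<Phi> q h" and por: "\<And>v. v \<in> V \<Longrightarrow> portrait q g v = portrait q h v"
  shows "g = h"
proof -
  \<comment> \<open>The image of the origin reaches the ray after \<open>n\<close> steps up;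
    commuting with \<open>ancestor\<close> transfers this to the images of \<open>\<omega> n\<close>
    and of all ray vertices above it.\<close>
  have omega: "\<exists>n. \<forall>m\<ge>n. \<exists>k. f (\<omega> m) = \<omega> k" if f: "f \<in> carrier (Aff q)" for f
  proof -
    have com: "f ((ancestor ^^ m) (\<omega> n)) = (ancestor ^^ m) (f (\<omega> n))" for m n
      by (intro commutes_funpow Aff_commutes_ancestor f omega_nodes)
    have "f origin \<in> V" using f omega_nodes by (simp add: Aff_nodes)
    then obtain n k where "(ancestor ^^ n) (f origin) = \<omega> k" by (rule ancestors_reach_omega)
    then have n: "f (\<omega> n) = \<omega> k" using com[of n 0] by (simp add: funpow_ancestor_omega)
    have "f (\<omega> (n + m)) = \<omega> (k + m)" for m using com[of m n] n by (simp add: funpow_ancestor_omega)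
    then show ?thesis by (metis le_Suc_ex)
  qed
  obtain n where n: "\<And>m. m \<ge> n \<Longrightarrow> \<exists>k. g (\<omega> m) = \<omega> k" using omega[OF g] by blast
  obtain n' where n': "\<And>m. m \<ge> n' \<Longrightarrow> \<exists>k. h (\<omega> m) = \<omega> k" using omega[OF h] by blast
  have top: "g (\<omega> m) = h (\<omega> m)" if "m \<ge> n + n'" for m
  proof -
    obtain k l where "g (\<omega> m) = \<omega> k" "h (\<omega> m) = \<omega> l" 
      using n[of m] n'[of m] \<open>m \<ge> n + n'\<close> by auto
    moreover from this have "int k = int l"
      using fst_Aff[OF g omega_nodes[of m]] fst_Aff[OF h omega_nodes[of m]] Phi
        fst_omega[of k] fst_omega[of l] by simp
    ultimately show ?thesis by simp
  qed
  have down: "g v = h v" if "v \<in> V" "g ((ancestor ^^ i) v) = h ((ancestor ^^ i) v)" for i v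
    using that
  proof (induction i arbitrary: v)
    case (Suc i)
    obtain t where t: "t < q" "v = child (ancestor v) t" using nodes_childE[OF Suc.prems(1)] .
    have a: "ancestor v \<in> V" using Suc.prems(1) by (rule ancestor_nodes)
    have "g (ancestor v) = h (ancestor v)"
      using Suc.IH[OF a] Suc.prems(2) by (simp add: funpow_swap1)
    then have "g (child (ancestor v) t) = h (child (ancestor v) t)"
      using portrait_spec(2)[OF g a t(1)] portrait_spec(2)[OF h a t(1)] por[OF a] by simp
    then show ?case using t(2) by simp
  qed simp
  show ?thesis
  proof
    fix v
    show "g v = h v"
    proof (cases "v \<in> V")
      case True
      then obtain i k where "(ancestor ^^ i) v = \<omega> k" by (rule ancestors_reach_omega)
      then have "(ancestor ^^ (n + n' + i)) v = \<omega> (k + (n + n'))"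
        using funpow_add[of "n + n'" i ancestor] by (simp add: funpow_ancestor_omega)
      then show ?thesis using down[OF True, of "n + n' + i"] top[of "k + (n + n')"] by simp
    next
      case False
      then show ?thesis
        using permutes_not_in[OF Aff_permutes[OF g]] permutes_not_in[OF Aff_permutes[OF h]] by simp
    qed
  qed
qed

subsection \<open>Elements supported at the origin\<close>

text \<open>An explicit candidate for \<open>\<delta> q \<sigma>\<close>. The vertices strictly
  below the origin are those of level at least 1 with zeros at all indices up to 0, and the label at
  the origin acts on their entry at index 1.\<close>

definition origin_perm :: "(nat \<Rightarrow> nat) \<Rightarrow> vertex \<Rightarrow> vertex" where
  "origin_perm \<sigma> v = (if v \<in> V \<and> fst v \<ge> 1 \<and> (\<forall>k\<le>0. snd v k = 0)
     then (fst v, (snd v)(1 := \<sigma> (snd v 1))) else v)"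

lemma origin_perm_Aff:
  assumes \<sigma>: "\<sigma> \<in> Sym q"
  shows "origin_perm \<sigma> \<in> carrier (Aff q)"
  unfolding Aff_iff
proof (intro conjI ballI)
  have nodes: "origin_perm \<tau> v \<in> V" if "\<tau> \<in> Sym q" "v \<in> V" for \<tau> v
  proof -
    obtain m u where mu: "v = (m, u)" by (cases v)
    have "\<tau> (u 1) < q" if "1 \<le> m"
      using that \<open>v \<in> V\<close> Sym_less[OF \<open>\<tau> \<in> Sym q\<close>] by (auto simp: mu nodes_Tr_iff)
    then show ?thesis
      using that by (auto simp: mu origin_perm_def nodes_Tr_iff intro!: exI[of _ 0])
  qed
  have inverse: "origin_perm \<rho> (origin_perm \<tau> v) = v"
    if "\<tau> \<in> Sym q" "\<And>t. \<rho> (\<tau> t) = t" "v \<in> V" for \<rho> \<tau> v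
    using nodes[OF that(1,3)] that(2,3) by (auto simp: origin_perm_def split: if_splits)
  have perm: "\<sigma> permutes {..<q}" using \<sigma> by simp
  then have "Hilbert_Choice.inv \<sigma> \<in> Sym q" by (simp add: permutes_inv)
  with perm \<sigma> have "bij_betw (origin_perm \<sigma>) V V"
    by (intro bij_betw_byWitness[of _ "origin_perm (Hilbert_Choice.inv \<sigma>)"])
      (auto simp: inverse nodes permutes_inverses)
  then show "origin_perm \<sigma> permutes V" by (rule bij_imp_permutes) (simp add: origin_perm_def)
  fix v assume v: "v \<in> V"
  show "origin_perm \<sigma> (ancestor v) = ancestor (origin_perm \<sigma> v)"
  proof (cases v)
    case (Pair m u)
    then show ?thesis
      using v ancestor_nodes[OF v] by (auto simp: origin_perm_def ancestor_def fun_upd_twist)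
  qed
qed

lemma Phi_origin_perm: "\<sigma> \<in> Sym q \<Longrightarrow> \<Phi> q (origin_perm \<sigma>) = 0"
  by (rule Phi_eqI[OF origin_perm_Aff _ omega_nodes[of 0]]) (simp_all add: origin_perm_def)

lemma eq_origin:
  assumes "(0, u) \<in> V" "\<forall>k\<le>0. u k = 0"
  shows "(0, u) = origin"
proof -
  have "u k = 0" for k using assms by (cases "k \<le> 0") (simp_all add: nodes_Tr_iff)
  then show ?thesis by (simp add: \<omega>_def fun_eq_iff)
qed

lemma portrait_origin_perm:
  assumes \<sigma>: "\<sigma> \<in> Sym q" and v: "v \<in> V"
  shows "portrait q (origin_perm \<sigma>) v = (if v = origin then \<sigma> else id)"
  unfolding portrait_eq[OF origin_perm_Aff[OF \<sigma>] v]
proof (rule hor_portrait_eqI)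
  show "(if v = origin then \<sigma> else id) \<in> Sym q" using \<sigma> by (simp add: permutes_id)
  fix t assume t: "t < q"
  obtain m u where mu: "v = (m, u)" by (cases v)
  note c = child_nodes[OF v t]
  have v0: "v = origin \<longleftrightarrow> m = 0 \<and> (\<forall>k\<le>0. u k = 0)"
    using eq_origin[of u] v by (auto simp: mu \<omega>_def)
  show "origin_perm \<sigma> (child v t) =
      child (origin_perm \<sigma> v) ((if v = origin then \<sigma> else id) t)"
  \<comment> \<open>In the first case \<open>v\<close> is the origin, where the appended entry is
    the permuted one, or lies below it, where appending commutes with the change at index 1.\<close>
  proof (cases "m \<ge> 0 \<and> (\<forall>k\<le>0. u k = 0)")
    case True
    then show ?thesis
      using v c unfolding v0 by (auto simp: mu origin_perm_def child_def fun_upd_twist)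
  next
    case False
    have "\<not> (m + 1 \<ge> 1 \<and> (\<forall>k\<le>0. (u(m + 1 := t)) k = 0))"
    proof
      assume *: "m + 1 \<ge> 1 \<and> (\<forall>k\<le>0. (u(m + 1 := t)) k = 0)"
      then have "(u(m + 1 := t)) k = u k" if "k \<le> 0" for k using that by simp
      then have "\<forall>k\<le>0. u k = 0" using * by metis
      then show False using False * by simp
    qed
    moreover have "v \<noteq> origin" unfolding v0 using False by auto
    ultimately show ?thesis
      using False by (auto simp: mu origin_perm_def child_def)
  qed
qed

lemma delta_eq:
  assumes \<sigma>: "\<sigma> \<in> Sym q"
  shows "\<delta> q \<sigma> = origin_perm \<sigma>"
  unfolding \<delta>_def
proof (rule the_equality)
  show "origin_perm \<sigma> \<in> Hor q \<and>
      (\<forall>v\<in>V. portrait q (origin_perm \<sigma>) v = (if v = origin then \<sigma> else id))"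
    using origin_perm_Aff[OF \<sigma>] Phi_origin_perm[OF \<sigma>] portrait_origin_perm[OF \<sigma>]
    by (simp add: Hor_def)
  fix \<gamma> assume "\<gamma> \<in> Hor q \<and> (\<forall>v\<in>V. portrait q \<gamma> v = (if v = origin then \<sigma> else id))"
  then show "\<gamma> = origin_perm \<sigma>"
    using origin_perm_Aff[OF \<sigma>] Phi_origin_perm[OF \<sigma>] portrait_origin_perm[OF \<sigma>]
    by (intro Aff_eqI) (auto simp: Hor_def)
qed

lemma delta_Aff: "\<sigma> \<in> Sym q \<Longrightarrow> \<delta> q \<sigma> \<in> carrier (Aff q)"
  and Phi_delta: "\<sigma> \<in> Sym q \<Longrightarrow> \<Phi> q (\<delta> q \<sigma>) = 0"
  and portrait_delta:
    "\<sigma> \<in> Sym q \<Longrightarrow> v \<in> V \<Longrightarrow> portrait q (\<delta> q \<sigma>) v = (if v = origin then \<sigma> else id)"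
  and delta_origin: "\<sigma> \<in> Sym q \<Longrightarrow> \<delta> q \<sigma> origin = origin"
  by (simp_all add: delta_eq origin_perm_Aff Phi_origin_perm portrait_origin_perm
      origin_perm_def fst_omega)

lemma delta_eq_origin_iff: "\<sigma> \<in> Sym q \<Longrightarrow> \<delta> q \<sigma> v = origin \<longleftrightarrow> v = origin"
  using Aff_inject[OF delta_Aff, of \<sigma> v origin] by (simp add: delta_origin)

lemma Sym_comp: "\<sigma> \<in> Sym q \<Longrightarrow> \<tau> \<in> Sym q \<Longrightarrow> \<sigma> \<circ> \<tau> \<in> Sym q"
  by (simp add: permutes_compose)

lemma id_Sym: "id \<in> Sym q"
  by (simp add: permutes_id)

lemma delta_mult:
  assumes "\<sigma> \<in> Sym q" "\<tau> \<in> Sym q"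
  shows "\<delta> q \<sigma> \<otimes>\<^bsub>Aff q\<^esub> \<delta> q \<tau> = \<delta> q (\<tau> \<circ> \<sigma>)"
proof (rule Aff_eqI)
  note s = Sym_comp[OF assms(2,1)]
  show "\<Phi> q (\<delta> q \<sigma> \<otimes>\<^bsub>Aff q\<^esub> \<delta> q \<tau>) = \<Phi> q (\<delta> q (\<tau> \<circ> \<sigma>))"
    by (simp only: Phi_mult delta_Aff Phi_delta s assms)
  show "portrait q (\<delta> q \<sigma> \<otimes>\<^bsub>Aff q\<^esub> \<delta> q \<tau>) v = portrait q (\<delta> q (\<tau> \<circ> \<sigma>)) v" if v: "v \<in> V" for v
    using portrait_mult[OF delta_Aff delta_Aff v, OF assms]
      portrait_delta[OF s v] portrait_delta[OF assms(1) v]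
      portrait_delta[OF assms(2), of "\<delta> q \<sigma> v"] v
    by (simp add: delta_eq_origin_iff[OF assms(1)] Aff_nodes[OF delta_Aff[OF assms(1)]])
qed (intro Aff.m_closed delta_Aff assms Sym_comp)+

lemma delta_id: "\<delta> q id = \<one>\<^bsub>Aff q\<^esub>"
proof (rule Aff_eqI)
  show "portrait q (\<delta> q id) v = portrait q \<one>\<^bsub>Aff q\<^esub> v" if "v \<in> V" for v
    using portrait_delta[OF id_Sym that] that by (simp add: portrait_eq hor_portrait_one)
qed (simp_all add: delta_Aff id_Sym Phi_delta Phi_one)

subsection \<open>The cursor of an element\<close>

abbreviation cursor :: "(vertex \<Rightarrow> vertex) \<Rightarrow> vertex" where
  "cursor g \<equiv> (inv\<^bsub>Aff q\<^esub> g) origin"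

lemma cursor_nodes: "g \<in> carrier (Aff q) \<Longrightarrow> cursor g \<in> V"
  by (simp add: Aff_nodes omega_nodes)

lemma cursor_eq_iff:
  assumes "g \<in> carrier (Aff q)"
  shows "cursor g = v \<longleftrightarrow> g v = origin"
proof
  assume "cursor g = v"
  then show "g v = origin" using inv_Aff(2)[OF assms, of origin] by (rule subst)
next
  assume "g v = origin"
  then show "cursor g = v" using inv_Aff(1)[OF assms, of v] by (rule subst)
qed

lemma fst_cursor:
  assumes "g \<in> carrier (Aff q)"
  shows "fst (cursor g) = - \<Phi> q g"
  using fst_Aff[OF assms cursor_nodes[OF assms]] unfolding inv_Aff(2)[OF assms]
  by (simp add: fst_omega)

lemma cursor_mult_delta:
  assumes "g \<in> carrier (Aff q)" "\<sigma> \<in> Sym q"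
  shows "cursor (g \<otimes>\<^bsub>Aff q\<^esub> \<delta> q \<sigma>) = cursor g"
proof -
  have "g \<otimes>\<^bsub>Aff q\<^esub> \<delta> q \<sigma> \<in> carrier (Aff q)" using assms delta_Aff by blast
  then show ?thesis
    using assms inv_Aff(2)[OF assms(1), of origin]
    by (subst cursor_eq_iff) (simp_all add: mult_Aff delta_origin)
qed

text \<open>The factor \<open>\<delta> q \<sigma>\<close> acts after \<open>g\<close> and is
  labelled at the origin only; the vertex that \<open>g\<close> brings there is the cursor.\<close>

lemma portrait_mult_delta:
  assumes "g \<in> carrier (Aff q)" "\<sigma> \<in> Sym q" "v \<in> V"
  shows "portrait q (g \<otimes>\<^bsub>Aff q\<^esub> \<delta> q \<sigma>) v =
    (if v = cursor g then \<sigma> \<circ> portrait q g v else portrait q g v)"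
  using portrait_mult[OF assms(1) delta_Aff[OF assms(2)] assms(3)]
    portrait_delta[OF assms(2), of "g v"] cursor_eq_iff[OF assms(1), of v]
    Aff_nodes[OF assms(1), of v] assms(3) by (cases "v = cursor g") simp_all

lemma alpha_pow_1:
  "\<alpha> q [^]\<^bsub>Aff q\<^esub> (1 :: int) = \<alpha> q"
  "\<alpha> q [^]\<^bsub>Aff q\<^esub> (- 1 :: int) = inv\<^bsub>Aff q\<^esub> \<alpha> q"
  using Aff.int_pow_1[OF alpha_Aff] Aff.int_pow_neg[OF alpha_Aff, of 1] by simp_all

lemma alpha_origin: "\<alpha> q origin = child origin 0"
  using omega_nodes[of 0] by (auto simp: \<alpha>_def \<omega>_def child_def)

lemma cursor_alpha: "cursor (\<alpha> q) = ancestor origin"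
proof -
  have "\<alpha> q (\<omega> 1) = origin"
    using omega_nodes[of 1] by (simp add: \<alpha>_def) (simp add: \<omega>_def)
  then show ?thesis using cursor_eq_iff[OF alpha_Aff, of "\<omega> 1"] by (simp add: ancestor_omega)
qed

lemma cursor_alpha_pow:
  assumes "\<epsilon> \<in> {1, - 1 :: int}"
  shows "{origin, cursor (\<alpha> q [^]\<^bsub>Aff q\<^esub> \<epsilon>)} \<in> edges (Tr q)"
proof -
  have "{origin, ancestor origin} \<in> edges (Tr q)" "{origin, child origin 0} \<in> edges (Tr q)"
    using omega_nodes[of 0] child_nodes[OF omega_nodes[of 0] q_pos]
      ancestor_child[OF omega_nodes[of 0]] by (simp_all add: edges_Tr_iff)
  moreover have "cursor (inv\<^bsub>Aff q\<^esub> \<alpha> q) = child origin 0"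
    using alpha_origin Aff.inv_inv[OF alpha_Aff] by simp
  ultimately show ?thesis using assms cursor_alpha alpha_pow_1 by (elim insertE) simp_all
qed

text \<open>The inverse of the product first moves the origin to a neighbour and then applies the
  inverse of \<open>g\<close>, which preserves edges.\<close>

lemma cursor_mult_alpha:
  assumes "g \<in> carrier (Aff q)" "\<epsilon> \<in> {1, - 1 :: int}"
  shows "{cursor g, cursor (g \<otimes>\<^bsub>Aff q\<^esub> \<alpha> q [^]\<^bsub>Aff q\<^esub> \<epsilon>)} \<in> edges (Tr q)"
proof -
  have "cursor (g \<otimes>\<^bsub>Aff q\<^esub> \<alpha> q [^]\<^bsub>Aff q\<^esub> \<epsilon>) = (inv\<^bsub>Aff q\<^esub> g) (cursor (\<alpha> q [^]\<^bsub>Aff q\<^esub> \<epsilon>))"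
    using assms(1) Aff.inv_mult_group[OF assms(1) Aff.int_pow_closed[OF alpha_Aff, of \<epsilon>]]
    by (simp add: mult_Aff)
  then show ?thesis
    using Aff_edge[OF Aff.inv_closed[OF assms(1)] cursor_alpha_pow[OF assms(2)]] by simp
qed

lemma supp_iff: "v \<in> supp q g \<longleftrightarrow> v \<in> V \<and> portrait q g v \<noteq> id"
  by (simp add: supp_def)

lemma supp_mult_delta:
  assumes "g \<in> carrier (Aff q)" "\<sigma> \<in> Sym q"
  shows "supp q (g \<otimes>\<^bsub>Aff q\<^esub> \<delta> q \<sigma>) \<subseteq> insert (cursor g) (supp q g)"
proof
  fix v assume v: "v \<in> supp q (g \<otimes>\<^bsub>Aff q\<^esub> \<delta> q \<sigma>)"
  then have "v \<in> V" by (simp add: supp_iff)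
  then show "v \<in> insert (cursor g) (supp q g)"
    using v portrait_mult_delta[OF assms] by (cases "v = cursor g") (simp_all add: supp_iff)
qed

lemma supp_mult_alpha:
  assumes "g \<in> carrier (Aff q)"
  shows "supp q (g \<otimes>\<^bsub>Aff q\<^esub> \<alpha> q [^]\<^bsub>Aff q\<^esub> (m :: int)) = supp q g"
  using portrait_mult_alpha_pow[OF assms] by (simp add: supp_iff set_eq_iff cong: conj_cong)

subsection \<open>Words and walks\<close>

abbreviation word_prod :: "(vertex \<Rightarrow> vertex) list \<Rightarrow> vertex \<Rightarrow> vertex" where
  "word_prod w \<equiv> foldr (\<lambda>x y. x \<otimes>\<^bsub>Aff q\<^esub> y) w \<one>\<^bsub>Aff q\<^esub>"

lemma S1_I:
  assumes "\<sigma> \<in> Sym q" "\<sigma>' \<in> Sym q" "\<epsilon> \<in> {1, - 1 :: int}"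
  shows "\<delta> q \<sigma> \<otimes>\<^bsub>Aff q\<^esub> (\<alpha> q [^]\<^bsub>Aff q\<^esub> \<epsilon>) \<otimes>\<^bsub>Aff q\<^esub> \<delta> q \<sigma>' \<in> S\<^sub>1 q"
  unfolding S\<^sub>1_def using assms by blast

lemma S1_E:
  assumes "s \<in> S\<^sub>1 q"
  obtains \<sigma> \<sigma>' \<epsilon> where "\<sigma> \<in> Sym q" "\<sigma>' \<in> Sym q" "\<epsilon> \<in> {1, - 1 :: int}"
    "s = \<delta> q \<sigma> \<otimes>\<^bsub>Aff q\<^esub> (\<alpha> q [^]\<^bsub>Aff q\<^esub> \<epsilon>) \<otimes>\<^bsub>Aff q\<^esub> \<delta> q \<sigma>'"
  using assms unfolding S\<^sub>1_def by blast

lemma S1_Aff: "S\<^sub>1 q \<subseteq> carrier (Aff q)"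
  by (auto elim!: S1_E simp: delta_Aff alpha_Aff)

lemma word_prod_Aff: "set w \<subseteq> S\<^sub>1 q \<Longrightarrow> word_prod w \<in> carrier (Aff q)"
  using S1_Aff by (induction w) auto

lemma word_prod_snoc:
  assumes "set w \<subseteq> S\<^sub>1 q" "s \<in> S\<^sub>1 q"
  shows "word_prod (w @ [s]) = word_prod w \<otimes>\<^bsub>Aff q\<^esub> s"
  using assms(1)
proof (induction w)
  case Nil
  then show ?case using assms(2) S1_Aff by auto
next
  case (Cons x w)
  then have "x \<in> carrier (Aff q)" "word_prod w \<in> carrier (Aff q)" "s \<in> carrier (Aff q)"
    using word_prod_Aff assms(2) S1_Aff by auto
  then show ?case using Cons by (simp add: Aff.m_assoc)
qed

lemma walk_of_word:
  assumes "set w \<subseteq> S\<^sub>1 q"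
  shows "\<exists>p. walk_between (Tr q) origin p (cursor (word_prod w)) \<and>
    supp q (word_prod w) \<subseteq> set p \<and> length p = Suc (length w)"
  using assms
proof (induction w rule: rev_induct)
  case Nil
  have "supp q \<one>\<^bsub>Aff q\<^esub> = {}"
    by (auto simp: supp_iff portrait_eq hor_portrait_one)
  moreover have "cursor \<one>\<^bsub>Aff q\<^esub> = origin" by (simp add: one_Aff[symmetric]) (simp add: one_Aff)
  ultimately show ?case
    using omega_nodes by (intro exI[of _ "[origin]"]) (simp add: walk_between_def walk_def)
next
  case (snoc s w)
  then have w: "set w \<subseteq> S\<^sub>1 q" and s: "s \<in> S\<^sub>1 q" by auto
  let ?g = "word_prod w"
  have g: "?g \<in> carrier (Aff q)" using w by (rule word_prod_Aff)
  obtain p where p: "walk_between (Tr q) origin p (cursor ?g)" "supp q ?g \<subseteq> set p"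
    "length p = Suc (length w)" using snoc.IH[OF w] by blast
  obtain \<sigma> \<sigma>' \<epsilon> where \<sigma>: "\<sigma> \<in> Sym q" "\<sigma>' \<in> Sym q" and \<epsilon>: "\<epsilon> \<in> {1, - 1 :: int}"
    and s_eq: "s = \<delta> q \<sigma> \<otimes>\<^bsub>Aff q\<^esub> (\<alpha> q [^]\<^bsub>Aff q\<^esub> \<epsilon>) \<otimes>\<^bsub>Aff q\<^esub> \<delta> q \<sigma>'"
    using S1_E[OF s] by blast
  let ?g1 = "?g \<otimes>\<^bsub>Aff q\<^esub> \<delta> q \<sigma>"
  let ?g2 = "?g1 \<otimes>\<^bsub>Aff q\<^esub> (\<alpha> q [^]\<^bsub>Aff q\<^esub> \<epsilon>)"
  have g1: "?g1 \<in> carrier (Aff q)" using g delta_Aff[OF \<sigma>(1)] by simp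
  have g2: "?g2 \<in> carrier (Aff q)" using g1 alpha_Aff by simp
  have prod: "word_prod (w @ [s]) = ?g2 \<otimes>\<^bsub>Aff q\<^esub> \<delta> q \<sigma>'"
    unfolding word_prod_snoc[OF w s] unfolding s_eq
    using g delta_Aff[OF \<sigma>(1)] delta_Aff[OF \<sigma>(2)] alpha_Aff by (simp add: Aff.m_assoc)
  define y where "y = cursor ?g2"
  have y: "{cursor ?g, y} \<in> edges (Tr q)" "y \<in> V" "cursor (word_prod (w @ [s])) = y"
    using cursor_mult_alpha[OF g1 \<epsilon>] cursor_nodes[OF g2]
    unfolding y_def prod cursor_mult_delta[OF g \<sigma>(1)] cursor_mult_delta[OF g2 \<sigma>(2)] by auto
  have "cursor ?g \<in> set p" using p(1) last_in_set[of p] by (simp add: walk_between_def walk_def)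
  moreover have "supp q (word_prod (w @ [s])) \<subseteq> insert y (insert (cursor ?g) (supp q ?g))"
    using supp_mult_delta[OF g2 \<sigma>(2)] supp_mult_delta[OF g \<sigma>(1)]
    unfolding prod supp_mult_alpha[OF g1] y_def by blast
  ultimately have "supp q (word_prod (w @ [s])) \<subseteq> set (p @ [y])" using p(2) by auto
  then show ?case
    using walk_between_snoc[OF p(1) y(2,1)] p(3) unfolding y(3)
    by (intro exI[of _ "p @ [y]"]) simp
qed

text \<open>Undoing the last step of a walk from \<open>z\<close> to \<open>y = cursor g\<close>.  If the walk has not visited
  \<open>y\<close> before, the portrait at \<open>y\<close> must be cleared at the same time; this is consistent with moving
  the cursor to \<open>z\<close> since a child \<open>z\<close> of \<open>y\<close> is then an ancestor of the origin.\<close>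

lemma last_step:
  assumes g: "g \<in> carrier (Aff q)" and p: "walk_between (Tr q) origin p z"
    and zy: "{z, cursor g} \<in> edges (Tr q)"
  obtains \<rho> \<epsilon> where "\<rho> \<in> Sym q" "\<epsilon> \<in> {1, - 1 :: int}"
    "(g \<otimes>\<^bsub>Aff q\<^esub> \<delta> q \<rho>) z = (\<alpha> q [^]\<^bsub>Aff q\<^esub> \<epsilon>) origin"
    "cursor g \<in> set p \<or> \<rho> \<circ> portrait q g (cursor g) = id"
proof -
  define y where "y = cursor g"
  define \<pi> where "\<pi> = portrait q g y"
  have yV: "y \<in> V" using cursor_nodes[OF g] by (simp add: y_def)
  have gy: "g y = origin" using inv_Aff(2)[OF g] by (simp add: y_def)
  have \<pi>: "\<pi> \<in> Sym q" using portrait_spec(1)[OF g yV] by (simp add: \<pi>_def)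
  then have perm: "\<pi> permutes {..<q}" by simp
  define \<rho>\<^sub>0 where "\<rho>\<^sub>0 = Hilbert_Choice.inv \<pi>"
  have \<rho>\<^sub>0: "\<rho>\<^sub>0 \<in> Sym q" "\<rho>\<^sub>0 \<circ> \<pi> = id"
    using permutes_inv[OF perm] permutes_inv_o(2)[OF perm] by (simp_all add: \<rho>\<^sub>0_def)
  have zV: "z \<in> V" using p last_in_set[of p] by (auto simp: walk_between_def walk_def)
  consider "z = ancestor y" | "y = ancestor z"
    using zy unfolding edges_Tr_iff y_def by blast
  then show ?thesis
  proof cases
    case 1
    \<comment> \<open>Any \<open>\<delta> q \<rho>\<close> fixes the ancestor of the origin, so here
      the choice of permutation is free and the label can be erased.\<close>
    have "(g \<otimes>\<^bsub>Aff q\<^esub> \<delta> q \<rho>\<^sub>0) z = ancestor ((g \<otimes>\<^bsub>Aff q\<^esub> \<delta> q \<rho>\<^sub>0) y)"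
      unfolding 1 using g delta_Aff[OF \<rho>\<^sub>0(1)] by (intro Aff_commutes_ancestor yV) simp
    also have "\<dots> = ancestor origin" by (simp add: mult_Aff gy delta_origin[OF \<rho>\<^sub>0(1)])
    also have "\<dots> = (\<alpha> q [^]\<^bsub>Aff q\<^esub> (- 1 :: int)) origin"
      unfolding alpha_pow_1 by (rule cursor_alpha[symmetric])
    finally show ?thesis using that[of \<rho>\<^sub>0 "- 1"] \<rho>\<^sub>0 by (simp add: y_def \<pi>_def)
  next
    case 2
    obtain t where t: "t < q" "z = child y t" using nodes_childE[OF zV] 2 by metis
    \<comment> \<open>The image of \<open>z\<close> under \<open>g\<close> is
      \<open>child origin (\<pi> t)\<close>. It has to go to \<open>child origin 0\<close>, the
      image of the origin under the shift.\<close>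
    have "\<exists>\<rho>\<in>Sym q. \<rho> (\<pi> t) = 0 \<and> (y \<in> set p \<or> \<rho> \<circ> \<pi> = id)"
    proof (cases "y \<in> set p")
      case True
      \<comment> \<open>An earlier visit to \<open>y\<close> can still deal with the label, so only
        the value at \<open>\<pi> t\<close> counts.\<close>
      have "transpose 0 (\<pi> t) \<in> Sym q"
        using q_pos t(1) Sym_less[OF \<pi>] by (simp add: permutes_swap_id)
      then show ?thesis using True by (intro bexI[of _ "transpose 0 (\<pi> t)"]) simp_all
    next
      case False
      \<comment> \<open>Missing \<open>y\<close>, the walk cannot use the edge from \<open>z\<close>
        to \<open>y\<close>, so it stays in the branch of \<open>z\<close>. The origin is thus below
        \<open>z\<close>, which puts \<open>z\<close> on the ray and forces
        \<open>t = 0\<close>.\<close>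
      have "successively (\<lambda>a b. {a, b} \<in> edges (Tr q) - {{z, ancestor z}}) p"
      proof (rule successively_mono[OF successively_set])
        show "successively (\<lambda>a b. {a, b} \<in> edges (Tr q)) p"
          using p by (simp add: walk_between_def walk_def)
        fix a b assume "{a, b} \<in> edges (Tr q) \<and> a \<in> set p \<and> b \<in> set p"
        moreover from this have "{a, b} \<noteq> {z, y}" using False by (auto simp: doubleton_eq_iff)
        ultimately show "{a, b} \<in> edges (Tr q) - {{z, ancestor z}}" using 2 by simp
      qed
      then have "below z z = below z (hd p)"
        using p last_in_set[of p]
        by (intro successively_below[OF _ _ zV, where F = "edges (Tr q) - {{z, ancestor z}}"])
          (auto simp: walk_between_def walk_def)
      then have "below z z = below z origin" using p by (simp add: walk_between_def)
      then obtain n where "(ancestor ^^ n) origin = z" using below_refl by (auto simp: below_def)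
      then have "z = \<omega> n" by (simp add: funpow_ancestor_omega)
      then have "snd (child y t) (fst (child y t)) = 0" using t(2) by (simp add: \<omega>_def)
      then have "t = 0" by (cases y) (simp add: child_def)
      moreover have "\<rho>\<^sub>0 (\<pi> t) = t" using \<rho>\<^sub>0(2) by (metis comp_apply id_apply)
      ultimately show ?thesis using \<rho>\<^sub>0 by (intro bexI[of _ \<rho>\<^sub>0]) simp_all
    qed
    then obtain \<rho> where \<rho>: "\<rho> \<in> Sym q" "\<rho> (\<pi> t) = 0" "y \<in> set p \<or> \<rho> \<circ> \<pi> = id" by blast
    have "(g \<otimes>\<^bsub>Aff q\<^esub> \<delta> q \<rho>) z = \<delta> q \<rho> (child origin (\<pi> t))"
      using portrait_spec(2)[OF g yV t(1)] by (simp add: mult_Aff t(2) gy \<pi>_def)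
    also have "\<dots> = child origin 0"
      using portrait_spec(2)[OF delta_Aff[OF \<rho>(1)] omega_nodes[of 0], of "\<pi> t"]
        Sym_less[OF \<pi>] t(1) portrait_delta[OF \<rho>(1) omega_nodes[of 0]]
      by (simp add: delta_origin[OF \<rho>(1)] \<rho>(2))
    also have "\<dots> = (\<alpha> q [^]\<^bsub>Aff q\<^esub> (1 :: int)) origin"
      unfolding alpha_pow_1 by (rule alpha_origin[symmetric])
    finally show ?thesis using that[of \<rho> 1] \<rho> by (simp add: y_def \<pi>_def)
  qed
qed

lemma word_of_walk:
  assumes "walk_between (Tr q) origin p (cursor g)" "g \<in> carrier (Aff q)" "supp q g \<subseteq> set p"
  shows "\<exists>\<tau>\<in>Sym q. \<exists>w. set w \<subseteq> S\<^sub>1 q \<and> length p = Suc (length w) \<and>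
    g = \<delta> q \<tau> \<otimes>\<^bsub>Aff q\<^esub> word_prod w"
  using assms
proof (induction p arbitrary: g rule: rev_induct)
  case Nil
  then show ?case by (simp add: walk_between_def walk_def)
next
  case (snoc y p)
  note g = snoc.prems(2)
  have y: "cursor g = y" using snoc.prems(1) by (simp add: walk_between_def)
  show ?case
  proof (cases "p = []")
    case True
    then have c: "cursor g = origin" using snoc.prems(1) y by (simp add: walk_between_def)
    let ?\<tau> = "portrait q g origin"
    have \<tau>: "?\<tau> \<in> Sym q" using portrait_spec(1)[OF g omega_nodes] .
    have "g = \<delta> q ?\<tau>"
    proof (rule Aff_eqI[OF g delta_Aff[OF \<tau>]])
      show "\<Phi> q g = \<Phi> q (\<delta> q ?\<tau>)"
        using fst_cursor[OF g] c Phi_delta[OF \<tau>] by (simp add: fst_omega)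
      show "portrait q g v = portrait q (\<delta> q ?\<tau>) v" if v: "v \<in> V" for v
        using portrait_delta[OF \<tau> v] snoc.prems(3) v True c y
        by (cases "v = origin") (auto simp: supp_iff)
    qed
    then have "g = \<delta> q ?\<tau> \<otimes>\<^bsub>Aff q\<^esub> word_prod []" using delta_Aff[OF \<tau>] by simp
    then show ?thesis using \<tau> True by (intro bexI[of _ ?\<tau>] exI[of _ "[]"]) auto
  next
    case False
    define z where "z = last p"
    have p: "walk_between (Tr q) origin p z" and zy: "{z, cursor g} \<in> edges (Tr q)"
      using snoc.prems(1) False unfolding y z_def
      by (auto simp: walk_between_def walk_def successively_append_iff)
    obtain \<rho> \<epsilon> where \<rho>: "\<rho> \<in> Sym q" and \<epsilon>: "\<epsilon> \<in> {1, - 1 :: int}"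
      and move: "(g \<otimes>\<^bsub>Aff q\<^esub> \<delta> q \<rho>) z = (\<alpha> q [^]\<^bsub>Aff q\<^esub> \<epsilon>) origin"
      and clear: "cursor g \<in> set p \<or> \<rho> \<circ> portrait q g (cursor g) = id"
      using last_step[OF g p zy] by blast
    define a where "a = \<alpha> q [^]\<^bsub>Aff q\<^esub> \<epsilon>"
    define g1 where "g1 = g \<otimes>\<^bsub>Aff q\<^esub> \<delta> q \<rho>"
    define g' where "g' = g1 \<otimes>\<^bsub>Aff q\<^esub> inv\<^bsub>Aff q\<^esub> a"
    have a: "a \<in> carrier (Aff q)" and g1: "g1 \<in> carrier (Aff q)" and g': "g' \<in> carrier (Aff q)"
      using g delta_Aff[OF \<rho>] alpha_Aff by (simp_all add: a_def g1_def g'_def)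
    have "g' z = origin"
      using inv_Aff(1)[OF a] move by (simp add: g'_def mult_Aff a_def g1_def)
    then have c': "cursor g' = z" using cursor_eq_iff[OF g'] by blast
    have inv_a: "inv\<^bsub>Aff q\<^esub> a = \<alpha> q [^]\<^bsub>Aff q\<^esub> (- \<epsilon>)"
      using Aff.int_pow_neg[OF alpha_Aff, of \<epsilon>] by (simp add: a_def)
    have "supp q g' = supp q g1"
      unfolding g'_def inv_a by (rule supp_mult_alpha[OF g1])
    also have "\<dots> \<subseteq> set p"
    proof
      fix v assume v: "v \<in> supp q g1"
      then have vV: "v \<in> V" by (simp add: supp_iff)
      show "v \<in> set p"
      proof (cases "v = cursor g")
        case True
        then show ?thesis
          using clear v portrait_mult_delta[OF g \<rho> vV] by (auto simp: supp_iff g1_def)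
      next
        case False
        then have "v \<in> supp q g"
          using v portrait_mult_delta[OF g \<rho> vV] by (simp add: supp_iff g1_def)
        then show ?thesis using snoc.prems(3) False y by auto
      qed
    qed
    finally have "supp q g' \<subseteq> set p" .
    then obtain \<tau> w where \<tau>: "\<tau> \<in> Sym q" and w: "set w \<subseteq> S\<^sub>1 q" "length p = Suc (length w)"
      and g'_eq: "g' = \<delta> q \<tau> \<otimes>\<^bsub>Aff q\<^esub> word_prod w"
      using snoc.IH[of g'] p g' c' by blast
    define \<rho>' where "\<rho>' = Hilbert_Choice.inv \<rho>"
    have perm: "\<rho> permutes {..<q}" using \<rho> by simp
    have \<rho>': "\<rho>' \<in> Sym q" "\<rho>' \<circ> \<rho> = id"
      using permutes_inv[OF perm] permutes_inv_o(2)[OF perm] by (simp_all add: \<rho>'_def)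
    \<comment> \<open>The left factor is trivial: labels are changed on arrival only, and the label
      that the origin needs before the first move is kept in \<open>\<tau>\<close>.\<close>
    define s where "s = \<delta> q id \<otimes>\<^bsub>Aff q\<^esub> a \<otimes>\<^bsub>Aff q\<^esub> \<delta> q \<rho>'"
    have s: "s \<in> S\<^sub>1 q" unfolding s_def a_def by (rule S1_I[OF id_Sym \<rho>'(1) \<epsilon>])
    have "g' \<otimes>\<^bsub>Aff q\<^esub> s = g1 \<otimes>\<^bsub>Aff q\<^esub> \<delta> q \<rho>'"
      by (rule ext) (simp add: s_def g'_def delta_id mult_Aff one_Aff inv_Aff(2)[OF a])
    also have "\<dots> = g \<otimes>\<^bsub>Aff q\<^esub> (\<delta> q \<rho> \<otimes>\<^bsub>Aff q\<^esub> \<delta> q \<rho>')"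
      using g delta_Aff[OF \<rho>'(1)] delta_Aff[OF \<rho>] by (simp add: g1_def Aff.m_assoc)
    also have "\<dots> = g" using g by (simp add: delta_mult[OF \<rho> \<rho>'(1)] \<rho>'(2) delta_id)
    finally have "g = \<delta> q \<tau> \<otimes>\<^bsub>Aff q\<^esub> word_prod (w @ [s])"
      using word_prod_snoc[OF w(1) s] word_prod_Aff[OF w(1)] delta_Aff[OF \<tau>] s S1_Aff
      by (simp add: g'_eq Aff.m_assoc subset_iff)
    then show ?thesis using \<tau> w s by (intro bexI[of _ \<tau>] exI[of _ "w @ [s]"]) auto
  qed
qed

section \<open>Word length\<close>

text \<open>The left permutation of the first letter absorbs the extra factor at no cost.\<close>

lemma delta_mult_word:
  assumes \<tau>: "\<tau> \<in> Sym q" and w: "set w \<subseteq> S\<^sub>1 q" "w \<noteq> []"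
  shows "\<exists>w'. set w' \<subseteq> S\<^sub>1 q \<and> length w' = length w \<and>
    word_prod w' = \<delta> q \<tau> \<otimes>\<^bsub>Aff q\<^esub> word_prod w"
proof -
  obtain s r where sr: "w = s # r" using w(2) by (cases w) auto
  then obtain \<sigma> \<sigma>' \<epsilon> where \<sigma>: "\<sigma> \<in> Sym q" "\<sigma>' \<in> Sym q" "\<epsilon> \<in> {1, - 1 :: int}"
    and s: "s = \<delta> q \<sigma> \<otimes>\<^bsub>Aff q\<^esub> (\<alpha> q [^]\<^bsub>Aff q\<^esub> \<epsilon>) \<otimes>\<^bsub>Aff q\<^esub> \<delta> q \<sigma>'"
    using S1_E[of s] w(1) by auto
  have r: "word_prod r \<in> carrier (Aff q)" using w(1) sr by (simp add: word_prod_Aff)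
  let ?s = "\<delta> q (\<sigma> \<circ> \<tau>) \<otimes>\<^bsub>Aff q\<^esub> (\<alpha> q [^]\<^bsub>Aff q\<^esub> \<epsilon>) \<otimes>\<^bsub>Aff q\<^esub> \<delta> q \<sigma>'"
  have "?s \<in> S\<^sub>1 q" by (intro S1_I Sym_comp \<sigma> \<tau>)
  moreover have "word_prod (?s # r) = \<delta> q \<tau> \<otimes>\<^bsub>Aff q\<^esub> word_prod w"
    unfolding sr s delta_mult[OF \<tau> \<sigma>(1), symmetric]
    using delta_Aff[OF \<tau>] delta_Aff[OF \<sigma>(1)] delta_Aff[OF \<sigma>(2)] alpha_Aff r
    by (simp add: Aff.m_assoc)
  ultimately show ?thesis using w(1) sr by (intro exI[of _ "?s # r"]) simp
qed

lemma word_length_eq: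
  assumes "set w \<subseteq> S\<^sub>1 q" "word_prod w = g"
    and "\<And>w'. set w' \<subseteq> S\<^sub>1 q \<Longrightarrow> word_prod w' = g \<Longrightarrow> length w \<le> length w'"
  shows "word_length (DA q) (S\<^sub>1 q) g = enat (length w)"
  unfolding word_length_def DA_def using assms
  by (intro antisym INF_lower2[of w] INF_greatest) auto

lemma TSP_le_word:
  assumes "set w \<subseteq> S\<^sub>1 q"
  shows "TSP (Tr q) (supp q (word_prod w)) origin (cursor (word_prod w)) \<le> length w"
  using walk_of_word[OF assms] TSP_le by blast

theorem word_length_eq_TSP:
  assumes "g \<in> carrier (DA q)" "g \<notin> \<delta> q ` Sym q"
  shows "word_length (DA q) (S\<^sub>1 q) g = enat (TSP (Tr q) (supp q g) origin (cursor g))"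
proof -
  have g: "g \<in> carrier (Aff q)" and fin: "finite (supp q g)" using assms(1) by (auto simp: DA_def)
  have "supp q g \<subseteq> V" by (auto simp: supp_iff)
  then obtain p where p: "walk_between (Tr q) origin p (cursor g)" "supp q g \<subseteq> set p"
    "length p = Suc (TSP (Tr q) (supp q g) origin (cursor g))"
    using TSP_eq(2)[OF omega_nodes cursor_nodes[OF g] fin] by blast
  obtain \<tau> w where \<tau>: "\<tau> \<in> Sym q" and w: "set w \<subseteq> S\<^sub>1 q" "length p = Suc (length w)"
    "g = \<delta> q \<tau> \<otimes>\<^bsub>Aff q\<^esub> word_prod w"
    using word_of_walk[OF p(1) g p(2)] by blast
  \<comment> \<open>The only use of the exclusion: an empty word would give
    \<open>g = \<delta> q \<tau>\<close>.\<close>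
  have "w \<noteq> []" using w(3) \<tau> assms(2) delta_Aff[OF \<tau>] by auto
  then obtain w' where "set w' \<subseteq> S\<^sub>1 q" "length w' = length w" "word_prod w' = g"
    using delta_mult_word[OF \<tau> w(1)] w(3) by auto
  note w' = this
  have T: "length w' = TSP (Tr q) (supp q g) origin (cursor g)" using w'(2) w(2) p(3) by simp
  have "length w' \<le> length r" if "set r \<subseteq> S\<^sub>1 q" "word_prod r = g" for r
    using TSP_le_word[OF that(1)] unfolding that(2) T .
  then show ?thesis using word_length_eq[OF w'(1,3)] unfolding T by blast
qed

text \<open>The optimal walk has length 0 and offers no letter to absorb the permutation, so the
  walk is lengthened by a detour to the ancestor and back. One letter is too few, because its height
  shift is 1 or -1 instead of 0.\<close>

theorem word_length_delta:
  assumes \<sigma>: "\<sigma> \<in> Sym q" and "\<sigma> \<noteq> id"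
  shows "word_length (DA q) (S\<^sub>1 q) (\<delta> q \<sigma>) = 2"
proof -
  note d = delta_Aff[OF \<sigma>]
  have c: "cursor (\<delta> q \<sigma>) = origin" using cursor_eq_iff[OF d] delta_origin[OF \<sigma>] by blast
  have "walk_between (Tr q) origin [origin, ancestor origin, origin] (cursor (\<delta> q \<sigma>))"
    unfolding c using omega_nodes ancestor_nodes[OF omega_nodes]
    by (simp add: walk_between_def walk_def edges_Tr_iff)
  moreover have "supp q (\<delta> q \<sigma>) \<subseteq> set [origin, ancestor origin, origin]"
    using portrait_delta[OF \<sigma>] by (auto simp: supp_iff)
  ultimately obtain \<tau> w where \<tau>: "\<tau> \<in> Sym q" and w: "set w \<subseteq> S\<^sub>1 q" "length w = 2"
    "\<delta> q \<sigma> = \<delta> q \<tau> \<otimes>\<^bsub>Aff q\<^esub> word_prod w"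
    using word_of_walk[OF _ d] by fastforce
  then have "w \<noteq> []" by auto
  then obtain w' where w': "set w' \<subseteq> S\<^sub>1 q" "length w' = 2" "word_prod w' = \<delta> q \<sigma>"
    using delta_mult_word[OF \<tau> w(1)] w(2,3) by auto
  have "2 \<le> length r" if r: "set r \<subseteq> S\<^sub>1 q" "word_prod r = \<delta> q \<sigma>" for r
  proof (rule ccontr)
    assume "\<not> 2 \<le> length r"
    then consider "r = []" | s where "r = [s]" by (cases r; cases "tl r") auto
    then show False
    proof cases
      case 1
      then have "portrait q (\<delta> q \<sigma>) origin = id"
        using r(2) by (simp add: portrait_eq omega_nodes hor_portrait_one flip: r(2))
      then show False using portrait_delta[OF \<sigma> omega_nodes[of 0]] \<open>\<sigma> \<noteq> id\<close> by simp
    next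
      case (2 s)
      then have s: "s \<in> S\<^sub>1 q" "s = \<delta> q \<sigma>" using r S1_Aff by auto
      obtain \<mu> \<mu>' \<epsilon> where \<mu>: "\<mu> \<in> Sym q" "\<mu>' \<in> Sym q" "\<epsilon> \<in> {1, - 1 :: int}"
        "s = \<delta> q \<mu> \<otimes>\<^bsub>Aff q\<^esub> (\<alpha> q [^]\<^bsub>Aff q\<^esub> \<epsilon>) \<otimes>\<^bsub>Aff q\<^esub> \<delta> q \<mu>'"
        using S1_E[OF s(1)] by blast
      then have "\<Phi> q s = \<epsilon>"
        using delta_Aff[OF \<mu>(1)] delta_Aff[OF \<mu>(2)] Phi_delta[OF \<mu>(1)] Phi_delta[OF \<mu>(2)]
        by (simp add: Phi_mult Phi_alpha_pow alpha_Aff)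
      then show False using \<mu>(3) s(2) Phi_delta[OF \<sigma>] by auto
    qed
  qed
  then show ?thesis using word_length_eq[OF w'(1,3)] w'(2) by (simp add: numeral_eq_enat)
qed

end

theorem proposition3p6:
  fixes q :: nat
  assumes "q \<ge> 2"
  shows "(\<forall>g \<in> carrier (DA q) - \<delta> q ` Sym q.
            word_length (DA q) (S\<^sub>1 q) g
              = enat (TSP (Tr q) (supp q g) origin ((inv\<^bsub>Aff q\<^esub> g) origin)) \<and>
            int (TSP (Tr q) (supp q g) origin ((inv\<^bsub>Aff q\<^esub> g) origin))
              = 2 * int (ell q g) - int (graph_dist (Tr q) origin ((inv\<^bsub>Aff q\<^esub> g) origin))) \<and>
         (\<forall>\<sigma> \<in> Sym q. \<sigma> \<noteq> id \<longrightarrow> word_length (DA q) (S\<^sub>1 q) (\<delta> q \<sigma>) = 2)"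
proof -
  interpret affine_tree q using assms by unfold_locales simp
  have "int (TSP (Tr q) (supp q g) origin (cursor g))
      = 2 * int (ell q g) - int (graph_dist (Tr q) origin (cursor g))"
    if "g \<in> carrier (DA q)" for g
  proof -
    have "g \<in> carrier (Aff q)" "finite (supp q g)" using that by (auto simp: DA_def)
    moreover have "supp q g \<subseteq> V" by (auto simp: supp_iff)
    ultimately show ?thesis
      unfolding ell_def by (intro TSP_smallest_subtree omega_nodes cursor_nodes)
  qed
  then show ?thesis using word_length_eq_TSP word_length_delta by blast
qed

end
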